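(* Given a connected $(P_2+3P_1)$-free graph $G$ with $n$ vertices and $m$ edges, one can decide whether $\operatorname{diam}(G)=6$ in $O(n+m)$ time. (Here $6=d_{\max}$, the maximum diameter of a connected $(P_2+3P_1)$-free graph.)
   Context: Graphs are finite, simple, undirected and unweighted. A graph is $H$-free if it does not contain $H$ as an induced subgraph; $P_2+3P_1$ is the disjoint union of an edge and three isolated vertices. $\operatorname{diam}(G)=\max_{u,v}d(u,v)$; $d_{\max}$ of a class is the supremum of the diameters of its graphs. *)

theory Defs
  imports "Graph_Theory.Graph_Theory"
begin

section \<open>Graphs\<close>

text \<open>
  Finite simple undirected graphs are the symmetric digraphs of the locale \<^locale>\<open>pair_graph\<close>;
  each undirected edge is the pair of arcs \<open>(u, v)\<close> and \<open>(v, u)\<close>.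
\<close>

definition num_verts :: "'a pair_pre_digraph \<Rightarrow> nat" where
  "num_verts G = card (pverts G)"

definition num_edges :: "'a pair_pre_digraph \<Rightarrow> nat" where
  "num_edges G = card {{u, v} | u v. (u, v) \<in> parcs G}"

definition induced_free :: "'a pair_pre_digraph \<Rightarrow> 'b pair_pre_digraph \<Rightarrow> bool" where
  "induced_free H G \<longleftrightarrow>
    \<not> (\<exists>K. induced_subgraph K (with_proj G) \<and> digraph_iso (with_proj H) K)"

definition P2_3P1 :: "nat pair_pre_digraph" where
  "P2_3P1 = \<lparr> pverts = {0, 1, 2, 3, 4}, parcs = {(0, 1), (1, 0)} \<rparr>"

definition graph_dist :: "'a pair_pre_digraph \<Rightarrow> 'a \<Rightarrow> 'a \<Rightarrow> ereal" where
  "graph_dist G u v = wf_digraph.\<mu> (with_proj G) (\<lambda>_. 1) u v"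

definition diam :: "'a pair_pre_digraph \<Rightarrow> ereal" where
  "diam G = Max {graph_dist G u v | u v. u \<in> pverts G \<and> v \<in> pverts G}"

text \<open>
  Every finite graph is isomorphic to one whose vertices are natural numbers, so it suffices to
  let a graph class be a predicate on the latter.
\<close>

definition d_max :: "(nat pair_pre_digraph \<Rightarrow> bool) \<Rightarrow> ereal" where
  "d_max \<C> = Sup {diam G | G. pair_graph G \<and> \<C> G}"

definition connected_P2_3P1_free :: "nat pair_pre_digraph \<Rightarrow> bool" where
  "connected_P2_3P1_free G \<longleftrightarrow> connected (with_proj G) \<and> induced_free P2_3P1 G"


section \<open>Unit-cost word RAM\<close>

text \<open>
  Programs of a random access machine in structured form, with registers and a memory indexed by
  natural numbers. A program mentions only finitely many registers.
\<close>

type_synonym reg = nat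

datatype test = Less reg reg | Leq reg reg | Eq reg reg | Neq reg reg

datatype prog =
    Const reg nat
  | Move reg reg
  | Add reg reg reg
  | Sub reg reg reg
  | Load reg reg      \<comment> \<open>\<open>Load i a\<close>: register \<open>i\<close> gets the memory cell addressed by register \<open>a\<close>\<close>
  | Store reg reg     \<comment> \<open>\<open>Store a i\<close>: the memory cell addressed by register \<open>a\<close> gets register \<open>i\<close>\<close>
  | Seq prog prog
  | If test prog prog
  | While test prog

type_synonym state = "(reg \<Rightarrow> nat) \<times> (nat \<Rightarrow> nat)"

primrec holds :: "test \<Rightarrow> (reg \<Rightarrow> nat) \<Rightarrow> bool" where
  "holds (Less i j) R \<longleftrightarrow> R i < R j"
| "holds (Leq i j) R \<longleftrightarrow> R i \<le> R j"
| "holds (Eq i j) R \<longleftrightarrow> R i = R j"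
| "holds (Neq i j) R \<longleftrightarrow> R i \<noteq> R j"

text \<open>
  \<open>exec B p s t s'\<close>: started in \<open>s\<close>, the program \<open>p\<close> halts in \<open>s'\<close> after exactly \<open>t\<close> steps. Each
  elementary instruction and each evaluation of a test is one step. A machine word holds a number
  below \<open>B\<close>; a run in which a larger number would enter a register is stuck and has no result.
  Since addresses come from registers, \<open>B\<close> also bounds the accessible memory. \<open>Sub\<close> is
  truncated subtraction.
\<close>

inductive exec :: "nat \<Rightarrow> prog \<Rightarrow> state \<Rightarrow> nat \<Rightarrow> state \<Rightarrow> bool" for B :: nat where
  Const: "n < B \<Longrightarrow> exec B (Const i n) (R, M) 1 (R(i := n), M)"
| Move: "exec B (Move i j) (R, M) 1 (R(i := R j), M)"
| Add: "R j + R k < B \<Longrightarrow> exec B (Add i j k) (R, M) 1 (R(i := R j + R k), M)"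
| Sub: "exec B (Sub i j k) (R, M) 1 (R(i := R j - R k), M)"
| Load: "M (R a) < B \<Longrightarrow> exec B (Load i a) (R, M) 1 (R(i := M (R a)), M)"
| Store: "exec B (Store a i) (R, M) 1 (R, M(R a := R i))"
| Seq: "exec B p s t s' \<Longrightarrow> exec B q s' u s'' \<Longrightarrow> exec B (Seq p q) s (t + u) s''"
| IfTrue: "holds b (fst s) \<Longrightarrow> exec B p s t s' \<Longrightarrow> exec B (If b p q) s (1 + t) s'"
| IfFalse: "\<not> holds b (fst s) \<Longrightarrow> exec B q s t s' \<Longrightarrow> exec B (If b p q) s (1 + t) s'"
| WhileFalse: "\<not> holds b (fst s) \<Longrightarrow> exec B (While b p) s 1 s"
| WhileTrue: "holds b (fst s) \<Longrightarrow> exec B p s t s' \<Longrightarrow> exec B (While b p) s' u s'' \<Longrightarrow>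
    exec B (While b p) s (1 + t + u) s''"

text \<open>Runs are deterministic, so the halting state and the running time are unique.\<close>

lemma exec_deterministic:
  assumes "exec B p s t s'" and "exec B p s u s''"
  shows "u = t \<and> s'' = s'"
  using assms
proof (induction arbitrary: u s'' rule: exec.induct)
  case (Seq p s t s' q u s'')
  from Seq.prems Seq.IH show ?case by (cases rule: exec.cases) blast+
next
  case (IfTrue b s p t s' q)
  from IfTrue.prems IfTrue.hyps IfTrue.IH show ?case by (cases rule: exec.cases) blast+
next
  case (IfFalse b s q t s' p)
  from IfFalse.prems IfFalse.hyps IfFalse.IH show ?case by (cases rule: exec.cases) blast+
next
  case (WhileFalse b s p)
  from WhileFalse.prems WhileFalse.hyps show ?case by (cases rule: exec.cases) blast+
next
  case (WhileTrue b s p t s' u s'')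
  from WhileTrue.prems WhileTrue.hyps WhileTrue.IH show ?case by (cases rule: exec.cases) blast+
qed (auto elim: exec.cases)


section \<open>Graph problems in linear time\<close>

text \<open>The vertices are \<open>0, \<dots>, n - 1\<close>; each adjacency list may be in any order.\<close>

definition adjacency_lists :: "nat pair_pre_digraph \<Rightarrow> nat list list \<Rightarrow> bool" where
  "adjacency_lists G adj \<longleftrightarrow>
    pverts G = {..<length adj} \<and>
    (\<forall>v<length adj. distinct (adj ! v) \<and> set (adj ! v) = {w. (v, w) \<in> parcs G})"

text \<open>
  Memory layout: cell \<open>0\<close> holds \<open>n\<close>; the list of vertex \<open>v < n\<close> occupies the cells from address
  \<open>mem (1 + v)\<close> up to, but excluding, address \<open>mem (2 + v)\<close>. Hence \<open>mem (1 + n)\<close> is the first address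
  behind the input. All other cells and all registers are initially \<open>0\<close>.
\<close>

definition input_cells :: "nat list list \<Rightarrow> nat list" where
  "input_cells adj =
    length adj #
    map (\<lambda>v. length adj + 2 + length (concat (take v adj))) [0..<length adj + 1] @
    concat adj"

definition initial_state :: "nat list list \<Rightarrow> state" where
  "initial_state adj =
    (\<lambda>_. 0, \<lambda>a. if a < length (input_cells adj) then input_cells adj ! a else 0)"

text \<open>
  Some program decides the property \<open>P\<close> of the graphs in the class \<open>\<C>\<close> in \<open>O(n + m)\<close> steps, using
  words of \<open>O(log (n + m))\<close> bits, that is, numbers below \<open>(n + m + 1) ^ k\<close>. The answer is left in
  register \<open>0\<close>. Nothing is required of the program on graphs outside \<open>\<C>\<close>.
\<close>

definition decidable_in_linear_time ::
  "(nat pair_pre_digraph \<Rightarrow> bool) \<Rightarrow> (nat pair_pre_digraph \<Rightarrow> bool) \<Rightarrow> bool" where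
  "decidable_in_linear_time \<C> P \<longleftrightarrow>
    (\<exists>p c k. \<forall>G adj. pair_graph G \<longrightarrow> \<C> G \<longrightarrow> adjacency_lists G adj \<longrightarrow>
      (\<exists>t R M.
        exec ((num_verts G + num_edges G + 1) ^ k) p (initial_state adj) t (R, M) \<and>
        t \<le> c * (num_verts G + num_edges G) \<and>
        R 0 = (if P G then 1 else 0)))"

end

theory Submission
  imports Defs
begin

text \<open>
  A shortest path with \<open>8\<close> vertices contains \<open>P\<^sub>2 + 3P\<^sub>1\<close>, so the diameter is at most \<open>6\<close>, and the path
  with \<open>7\<close> vertices attains it. Let \<open>u\<close> and \<open>v\<close> be at distance \<open>6\<close>. An edge at \<open>u\<close> has no neighbours
  among the vertices at distance at least \<open>3\<close> from \<open>u\<close>, so among these there are no three independent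
  ones, and likewise for \<open>v\<close>. It follows that the graph has independence number at most \<open>4\<close> and that
  \<open>u\<close> is simplicial. Hence, if a vertex \<open>w\<close> of the closed neighbourhood of \<open>u\<close> has no larger degree
  than \<open>u\<close>, it is a true twin of \<open>u\<close> and has eccentricity \<open>6\<close> as well.

  The program therefore picks four times an unmarked vertex \<open>w\<close> of minimal degree, explores the ball of
  radius \<open>5\<close> around \<open>w\<close>, answers yes if it is not the whole graph, and marks the closed
  neighbourhood of \<open>w\<close>. If all four picks failed, \<open>u\<close> was never marked, and together with the picks it
  would form an independent set of size \<open>5\<close>.
\<close>

section \<open>Distances and induced subgraphs\<close>

text \<open>Arcs of a pair digraph are determined by their ends, so an isomorphism onto an induced
  subgraph amounts to its vertex map; conversely a vertex embedding \<open>g\<close> acts on arcs as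
  \<open>map_prod g g\<close>.\<close>

lemma induced_free_iff:
  assumes "pair_wf_digraph H" and "pair_wf_digraph G"
  shows "induced_free H G \<longleftrightarrow>
    \<not> (\<exists>f. inj_on f (pverts H) \<and> f ` pverts H \<subseteq> pverts G \<and>
      (\<forall>i \<in> pverts H. \<forall>j \<in> pverts H. (f i, f j) \<in> parcs G \<longleftrightarrow> (i, j) \<in> parcs H))"
    (is "_ \<longleftrightarrow> \<not> (\<exists>f. ?emb f)")
proof -
  interpret H: pair_wf_digraph H by fact
  interpret G: pair_wf_digraph G by fact
  have emb_of_iso: "?emb (iso_verts f)"
    if f: "pre_digraph.digraph_isomorphism (with_proj H) f"
      and K: "induced_subgraph (app_iso f (with_proj H)) (with_proj G)" for f
  proof -
    have sub: "iso_verts f ` pverts H \<subseteq> pverts G" "iso_tail f = fst" "iso_head f = snd"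
      and arcs: "iso_arcs f ` parcs H =
        {e \<in> parcs G. fst e \<in> iso_verts f ` pverts H \<and> snd e \<in> iso_verts f ` pverts H}"
      using K by (auto simp: induced_subgraph_def subgraph_def compatible_def)
    have inj: "inj_on (iso_verts f) (pverts H)"
      and ends: "\<And>a. a \<in> parcs H \<Longrightarrow>
        iso_verts f (fst a) = fst (iso_arcs f a) \<and> iso_verts f (snd a) = snd (iso_arcs f a)"
      using f sub by (auto simp: pre_digraph.digraph_isomorphism_def)
    have "(iso_verts f i, iso_verts f j) \<in> parcs G \<longleftrightarrow> (i, j) \<in> parcs H"
      if "i \<in> pverts H" "j \<in> pverts H" for i j
    proof
      assume "(i, j) \<in> parcs H"
      then have "iso_arcs f (i, j) \<in> parcs G" using arcs by blast
      with ends[OF \<open>(i, j) \<in> parcs H\<close>] show "(iso_verts f i, iso_verts f j) \<in> parcs G"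
        by simp
    next
      \<comment> \<open>Being induced, the image contains this arc; its preimage has the ends
        \<open>i\<close> and \<open>j\<close> because the vertex map is injective.\<close>
      assume "(iso_verts f i, iso_verts f j) \<in> parcs G"
      with that have "(iso_verts f i, iso_verts f j) \<in> iso_arcs f ` parcs H"
        unfolding arcs by simp
      then obtain a where a: "a \<in> parcs H" "iso_arcs f a = (iso_verts f i, iso_verts f j)"
        by (metis imageE)
      with ends[OF a(1)] inj that have "a = (i, j)"
        by (metis H.arc_fst_in_verts H.arc_snd_in_verts fst_conv inj_onD prod.collapse snd_conv)
      with a show "(i, j) \<in> parcs H" by simp
    qed
    with inj sub show ?thesis by blast
  qed
  have iso_of_emb: "\<exists>K. induced_subgraph K (with_proj G) \<and> digraph_iso (with_proj H) K"
    if emb: "?emb g" for g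
  proof -
    define f where "f = \<lparr>iso_verts = g, iso_arcs = map_prod g g, iso_head = snd, iso_tail = fst\<rparr>"
    have vs: "fst a \<in> pverts H" "snd a \<in> pverts H" if "a \<in> parcs H" for a
      using that H.arc_fst_in_verts H.arc_snd_in_verts by auto
    have "inj_on (map_prod g g) (parcs H)"
    proof (rule inj_onI)
      fix a b assume "a \<in> parcs H" "b \<in> parcs H" "map_prod g g a = map_prod g g b"
      then show "a = b"
        using emb vs by (metis fst_map_prod inj_onD prod_eqI snd_map_prod)
    qed
    then have iso: "pre_digraph.digraph_isomorphism (with_proj H) f"
      using emb H.wf_digraph_axioms by (auto simp: pre_digraph.digraph_isomorphism_def f_def)
    have wf: "wf_digraph (app_iso f (with_proj H))"
      using H.wf_digraphI_app_iso[OF iso] .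
    have "map_prod g g ` parcs H = {e \<in> parcs G. fst e \<in> g ` pverts H \<and> snd e \<in> g ` pverts H}"
    proof (intro equalityI subsetI)
      fix e assume "e \<in> map_prod g g ` parcs H"
      then obtain i j where ij: "(i, j) \<in> parcs H" "e = (g i, g j)" by auto
      moreover have "(g i, g j) \<in> parcs G" "i \<in> pverts H" "j \<in> pverts H"
        using emb vs[OF ij(1)] ij(1) by simp_all
      ultimately show "e \<in> {e \<in> parcs G. fst e \<in> g ` pverts H \<and> snd e \<in> g ` pverts H}"
        by simp
    next
      fix e assume "e \<in> {e \<in> parcs G. fst e \<in> g ` pverts H \<and> snd e \<in> g ` pverts H}"
      then obtain i j where "i \<in> pverts H" "j \<in> pverts H" "e = (g i, g j)" "e \<in> parcs G"
        by (cases e) auto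
      with emb have "(i, j) \<in> parcs H" by simp
      with \<open>e = (g i, g j)\<close> show "e \<in> map_prod g g ` parcs H" by (intro rev_image_eqI) auto
    qed
    then have "induced_subgraph (app_iso f (with_proj H)) (with_proj G)"
      using wf emb G.wf_digraph_axioms
      by (auto simp: induced_subgraph_def subgraph_def compatible_def f_def)
    with iso show ?thesis unfolding digraph_iso_def by blast
  qed
  have "(\<exists>K. induced_subgraph K (with_proj G) \<and> digraph_iso (with_proj H) K) \<longleftrightarrow> (\<exists>f. ?emb f)"
  proof
    assume "\<exists>K. induced_subgraph K (with_proj G) \<and> digraph_iso (with_proj H) K"
    then obtain f where "pre_digraph.digraph_isomorphism (with_proj H) f"
      "induced_subgraph (app_iso f (with_proj H)) (with_proj G)"
      unfolding digraph_iso_def by (elim exE conjE) simp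
    then show "\<exists>f. ?emb f" by (intro exI, rule emb_of_iso)
  next
    assume "\<exists>f. ?emb f"
    then obtain f where "?emb f" by (rule exE)
    then show "\<exists>K. induced_subgraph K (with_proj G) \<and> digraph_iso (with_proj H) K"
      by (rule iso_of_emb)
  qed
  then show ?thesis by (simp only: induced_free_def)
qed

lemma induced_free_P2_3P1_iff:
  assumes "pair_graph G"
  shows "induced_free P2_3P1 G \<longleftrightarrow>
    \<not> (\<exists>a b x y z. {a, b, x, y, z} \<subseteq> pverts G \<and> (a, b) \<in> parcs G \<and> distinct [a, b, x, y, z] \<and>
      {(a, x), (a, y), (a, z), (b, x), (b, y), (b, z), (x, y), (x, z), (y, z)} \<inter> parcs G = {})"
    (is "_ \<longleftrightarrow> \<not> ?R")
proof -
  interpret pair_graph G by fact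
  have H: "pair_wf_digraph P2_3P1" by unfold_locales (auto simp: P2_3P1_def)
  have sym: "(u, v) \<in> parcs G \<longleftrightarrow> (v, u) \<in> parcs G" for u v
    using arcs_symmetric by blast
  have irr: "(u, u) \<notin> parcs G" for u using no_loops by force
  have pattern: "?R" if inj: "inj_on f (pverts P2_3P1)" and sub: "f ` pverts P2_3P1 \<subseteq> pverts G"
    and iff: "\<forall>i \<in> pverts P2_3P1. \<forall>j \<in> pverts P2_3P1.
      (f i, f j) \<in> parcs G \<longleftrightarrow> (i, j) \<in> parcs P2_3P1" for f
  proof (intro exI conjI)
    show "{f 0, f 1, f 2, f 3, f 4} \<subseteq> pverts G" using sub by (simp add: P2_3P1_def)
    show "(f 0, f 1) \<in> parcs G" using iff by (simp add: P2_3P1_def)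
    show "distinct [f 0, f 1, f 2, f 3, f 4]" using inj by (simp add: P2_3P1_def)
    show "{(f 0, f 2), (f 0, f 3), (f 0, f 4), (f 1, f 2), (f 1, f 3), (f 1, f 4),
      (f 2, f 3), (f 2, f 4), (f 3, f 4)} \<inter> parcs G = {}"
      using iff by (simp add: P2_3P1_def)
  qed
  have copy: "\<exists>f. inj_on f (pverts P2_3P1) \<and> f ` pverts P2_3P1 \<subseteq> pverts G \<and>
      (\<forall>i \<in> pverts P2_3P1. \<forall>j \<in> pverts P2_3P1. (f i, f j) \<in> parcs G \<longleftrightarrow> (i, j) \<in> parcs P2_3P1)"
    if "{a, b, x, y, z} \<subseteq> pverts G" "(a, b) \<in> parcs G" "distinct [a, b, x, y, z]"
      and disj: "{(a, x), (a, y), (a, z), (b, x), (b, y), (b, z), (x, y), (x, z), (y, z)} \<inter> parcs G = {}"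
    for a b x y z
  proof (intro exI[of _ "(!) [a, b, x, y, z]"] conjI)
    have verts: "pverts P2_3P1 = set [0, 1, 2, 3, 4]" by (simp add: P2_3P1_def)
    show "inj_on ((!) [a, b, x, y, z]) (pverts P2_3P1)"
      using that(3) by (intro inj_on_nth) (simp_all add: verts)
    show "(!) [a, b, x, y, z] ` pverts P2_3P1 \<subseteq> pverts G"
      using that(1) by (simp add: verts numeral_eq_Suc)
    \<comment> \<open>The nine non-adjacent pairs are listed in one direction only; symmetry
      supplies the other.\<close>
    have non: "(c, d) \<notin> parcs G" "(d, c) \<notin> parcs G"
      if "(c, d) \<in> {(a, x), (a, y), (a, z), (b, x), (b, y), (b, z), (x, y), (x, z), (y, z)}"
      for c d
      using disjoint_iff[THEN iffD1, OF disj, rule_format, OF that] sym[of c d] by simp_all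
    show "\<forall>i \<in> pverts P2_3P1. \<forall>j \<in> pverts P2_3P1.
        ([a, b, x, y, z] ! i, [a, b, x, y, z] ! j) \<in> parcs G \<longleftrightarrow> (i, j) \<in> parcs P2_3P1"
      using that(2) sym[of a b] by (simp add: P2_3P1_def numeral_eq_Suc irr non)
  qed
  have "(\<exists>f. inj_on f (pverts P2_3P1) \<and> f ` pverts P2_3P1 \<subseteq> pverts G \<and>
      (\<forall>i \<in> pverts P2_3P1. \<forall>j \<in> pverts P2_3P1.
        (f i, f j) \<in> parcs G \<longleftrightarrow> (i, j) \<in> parcs P2_3P1)) \<longleftrightarrow> ?R"
    by (rule iffI; elim exE conjE) (rule pattern copy; assumption)+
  then show ?thesis
    unfolding induced_free_iff[OF H pair_wf_digraph] by (simp only:)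
qed

section \<open>Distances in a connected graph as natural numbers\<close>

locale connected_pair_graph = pair_graph +
  assumes connected: "connected (with_proj G)"
begin

text \<open>For an unreachable pair \<open>LEAST\<close> has no specified value, which is why most
  facts below assume that the arguments are vertices.\<close>

definition hops :: "'a \<Rightarrow> 'a \<Rightarrow> nat" where
  "hops u v = (LEAST k. (u, v) \<in> parcs G ^^ k)"

lemma verts_nonempty: "pverts G \<noteq> {}"
  using connected by (auto simp: connected_def strongly_connected_def mk_symmetric_def)

lemma relpow_hops:
  assumes "u \<in> pverts G" "v \<in> pverts G"
  shows "(u, v) \<in> parcs G ^^ hops u v"
proof -
  \<comment> \<open>\<open>connected\<close> refers to the symmetric closure, which adds no arcs to
    a symmetric graph.\<close>
  have "parcs (mk_symmetric (with_proj G)) = parcs G"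
    using arcs_symmetric by (auto simp: mk_symmetric_def)
  moreover have "pverts (mk_symmetric (with_proj G)) = pverts G"
    by (simp add: mk_symmetric_def)
  ultimately have "(u, v) \<in> rtrancl_on (pverts G) (parcs G)"
    using connected assms by (auto simp: connected_def strongly_connected_def reachable_def)
  then have "(u, v) \<in> (parcs G)\<^sup>*" by (rule rtrancl_on_rtranclI)
  then obtain k where "(u, v) \<in> parcs G ^^ k" by (auto simp: rtrancl_power)
  then show ?thesis unfolding hops_def by (rule LeastI)
qed

lemma hops_le: "(u, v) \<in> parcs G ^^ k \<Longrightarrow> hops u v \<le> k"
  unfolding hops_def by (rule Least_le)

lemma hops_triangle:
  assumes "u \<in> pverts G" "v \<in> pverts G" "w \<in> pverts G"
  shows "hops u w \<le> hops u v + hops v w"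
  using relpow_hops[of u v] relpow_hops[of v w] assms by (auto intro!: hops_le simp: relpow_add)

lemma relpow_sym: "(u, v) \<in> parcs G ^^ k \<Longrightarrow> (v, u) \<in> parcs G ^^ k"
proof (induction k arbitrary: v)
  case (Suc k)
  then obtain w where "(u, w) \<in> parcs G ^^ k" "(w, v) \<in> parcs G" by auto
  with Suc.IH arcs_symmetric show ?case by (meson relpow_Suc_I2)
qed simp

lemma hops_sym: "hops u v = hops v u"
  unfolding hops_def using relpow_sym by meson

lemma hops_eq_0_iff: "u \<in> pverts G \<Longrightarrow> v \<in> pverts G \<Longrightarrow> hops u v = 0 \<longleftrightarrow> u = v"
  using relpow_hops[of u v] hops_le[of u v 0] by auto

lemma hops_eq_1_iff: "u \<in> pverts G \<Longrightarrow> v \<in> pverts G \<Longrightarrow> hops u v = 1 \<longleftrightarrow> (u, v) \<in> parcs G"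
  using relpow_hops[of u v] hops_le[of u v 1] hops_eq_0_iff[of u v] no_loops'[of u v] by fastforce

lemma hops_le_1_iff:
  "u \<in> pverts G \<Longrightarrow> v \<in> pverts G \<Longrightarrow> hops u v \<le> 1 \<longleftrightarrow> u = v \<or> (u, v) \<in> parcs G"
  using hops_eq_0_iff[of u v] hops_eq_1_iff[of u v] by linarith

lemma hops_pred:
  assumes "u \<in> pverts G" "v \<in> pverts G" "hops u v = Suc k"
  obtains w where "w \<in> pverts G" "(w, v) \<in> parcs G" "hops u w = k"
proof -
  have "(u, v) \<in> parcs G ^^ Suc k" using relpow_hops assms by metis
  then obtain w where w: "(u, w) \<in> parcs G ^^ k" "(w, v) \<in> parcs G" by auto
  have "w \<in> pverts G" using w(2) in_arcsD1 by blast
  moreover have "hops u v \<le> hops u w + 1"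
    using hops_triangle[of u w v] hops_eq_1_iff[of w v] \<open>w \<in> pverts G\<close> assms w by simp
  ultimately show thesis using that[of w] w hops_le[OF w(1)] assms by auto
qed

text \<open>A shortest path meets every level. The induction steps back along its last arc and only
  bounds \<open>hops w v\<close> from above; the triangle inequality turns this into
  equality.\<close>

lemma hops_between:
  assumes "u \<in> pverts G" "v \<in> pverts G" "k \<le> hops u v"
  obtains w where "w \<in> pverts G" "hops u w = k" "hops w v = hops u v - k"
proof -
  have "\<exists>w \<in> pverts G. hops u w = k \<and> hops w v \<le> hops u v - k"
    using assms(2,3)
  proof (induction "hops u v" arbitrary: v)
    case 0
    then have "u = v" "k = 0" using assms(1) hops_eq_0_iff[of u v] by simp_all
    with 0 show ?case by (intro bexI[of _ v]) simp_all
  next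
    case (Suc m)
    show ?case
    proof (cases "k = Suc m")
      case True then show ?thesis using Suc hops_eq_0_iff[of v v] by auto
    next
      case False
      obtain x where x: "x \<in> pverts G" "(x, v) \<in> parcs G" "hops u x = m"
        using hops_pred[of u v m] Suc assms(1) by metis
      then obtain w where w: "w \<in> pverts G" "hops u w = k" "hops w x \<le> m - k"
        using Suc False by fastforce
      have "hops w v \<le> hops w x + 1"
        using hops_triangle[of w x v] hops_eq_1_iff[of x v] x w Suc by simp
      then show ?thesis using w Suc False by fastforce
    qed
  qed
  then obtain w where "w \<in> pverts G" "hops u w = k" "hops w v \<le> hops u v - k" by blast
  moreover have "hops u v \<le> hops u w + hops w v" using hops_triangle calculation assms by blast
  ultimately show thesis using that[of w] by simp
qed

text \<open>Links walks, whose costs define \<open>graph_dist\<close>, with relation powers, which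
  define \<open>hops\<close>. Walks are lists that grow at the front, so the induction peels off the
  first arc.\<close>

lemma awalk_iff_relpow:
  assumes "u \<in> pverts G"
  shows "(\<exists>p. awalk u p v \<and> length p = k) \<longleftrightarrow> (u, v) \<in> parcs G ^^ k"
  using assms
proof (induction k arbitrary: u)
  case 0
  then show ?case by (auto simp: awalk_Nil_iff)
next
  case (Suc k)
  have "(\<exists>p. awalk u p v \<and> length p = Suc k) \<longleftrightarrow>
      (\<exists>w. (u, w) \<in> parcs G \<and> (\<exists>p. awalk w p v \<and> length p = k))"
  proof
    assume "\<exists>p. awalk u p v \<and> length p = Suc k"
    then obtain e p where "awalk u (e # p) v" "length p = k" by (metis length_Suc_conv)
    then show "\<exists>w. (u, w) \<in> parcs G \<and> (\<exists>p. awalk w p v \<and> length p = k)"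
      by (intro exI[of _ "snd e"]) (cases e, auto simp: awalk_Cons_iff)
  next
    assume "\<exists>w. (u, w) \<in> parcs G \<and> (\<exists>p. awalk w p v \<and> length p = k)"
    then obtain w p where "(u, w) \<in> parcs G" "awalk w p v" "length p = k" by blast
    then show "\<exists>p. awalk u p v \<and> length p = Suc k"
      by (intro exI[of _ "(u, w) # p"]) (simp add: awalk_Cons_iff)
  qed
  also have "\<dots> \<longleftrightarrow> (\<exists>w. (u, w) \<in> parcs G \<and> (w, v) \<in> parcs G ^^ k)"
    using Suc.IH in_arcsD2 by blast
  also have "\<dots> \<longleftrightarrow> (u, v) \<in> parcs G ^^ Suc k"
    by (meson relpow_Suc_D2 relpow_Suc_I2)
  finally show ?case .
qed

lemma graph_dist_eq_hops:
  assumes "u \<in> pverts G" "v \<in> pverts G"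
  shows "graph_dist G u v = ereal (real (hops u v))"
proof -
  have cost: "awalk_cost (\<lambda>_. 1) p = real (length p)" for p
    by (simp add: awalk_cost_def sum_list_triv)
  obtain p where "awalk u p v" "length p = hops u v"
    using awalk_iff_relpow[of u v] relpow_hops assms by blast
  moreover have "hops u v \<le> length q" if "awalk u q v" for q
    using awalk_iff_relpow[of u v "length q"] that assms by (auto intro: hops_le)
  ultimately show ?thesis
    unfolding graph_dist_def \<mu>_def cost
    by (intro INF_eqI) (simp, metis mem_Collect_eq)
qed

lemma diam_eq_iff:
  "diam G = ereal (real k) \<longleftrightarrow>
    (\<forall>u \<in> pverts G. \<forall>v \<in> pverts G. hops u v \<le> k) \<and>
    (\<exists>u \<in> pverts G. \<exists>v \<in> pverts G. hops u v = k)"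
proof -
  let ?D = "(\<lambda>(u, v). ereal (real (hops u v))) ` (pverts G \<times> pverts G)"
  have D: "{graph_dist G u v | u v. u \<in> pverts G \<and> v \<in> pverts G} = ?D"
    using graph_dist_eq_hops by (auto simp: image_iff) (metis)+
  \<comment> \<open>\<open>Max\<close> is meaningful only on a finite nonempty set; connectedness
    provides a vertex.\<close>
  have "finite ?D" "?D \<noteq> {}" using pair_finite_verts verts_nonempty by auto
  then have "Max ?D = ereal (real k) \<longleftrightarrow> ereal (real k) \<in> ?D \<and> (\<forall>d \<in> ?D. d \<le> ereal (real k))"
    by (metis Max_eq_iff)
  then show ?thesis unfolding diam_def D by (auto simp: image_iff)
qed

lemma diam_le_iff:
  "diam G \<le> ereal (real k) \<longleftrightarrow> (\<forall>u \<in> pverts G. \<forall>v \<in> pverts G. hops u v \<le> k)"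
proof -
  let ?D = "(\<lambda>(u, v). ereal (real (hops u v))) ` (pverts G \<times> pverts G)"
  have D: "{graph_dist G u v | u v. u \<in> pverts G \<and> v \<in> pverts G} = ?D"
    using graph_dist_eq_hops by (auto simp: image_iff) (metis)+
  have "finite ?D" "?D \<noteq> {}" using pair_finite_verts verts_nonempty by auto
  then show ?thesis unfolding diam_def D by auto
qed

lemma hops_arc:
  assumes "u \<in> pverts G" "(x, y) \<in> parcs G"
  shows "hops u y \<le> hops u x + 1"
  using hops_triangle[of u x y] hops_eq_1_iff[of x y] assms in_arcsD1 in_arcsD2 by auto

lemma hops_arc_rev:
  assumes "u \<in> pverts G" "(x, y) \<in> parcs G"
  shows "hops u x \<le> hops u y + 1"
  using hops_arc assms arcs_symmetric by blast

end

section \<open>Graphs without induced \<open>P\<^sub>2 + 3P\<^sub>1\<close>\<close>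

locale connected_P2_3P1_free_graph = connected_pair_graph +
  assumes free: "induced_free P2_3P1 G"
begin

definition independent :: "'a set \<Rightarrow> bool" where
  "independent S \<longleftrightarrow> S \<subseteq> pverts G \<and> (\<forall>x \<in> S. \<forall>y \<in> S. (x, y) \<notin> parcs G)"

lemma independent_subset: "independent S \<Longrightarrow> T \<subseteq> S \<Longrightarrow> independent T"
  unfolding independent_def by blast

text \<open>An edge at \<open>u\<close> and three independent vertices at distance at least \<open>3\<close> from \<open>u\<close> form a
  forbidden subgraph.\<close>

lemma card_independent_far_le:
  assumes u: "u \<in> pverts G" and S: "independent S" and far: "\<And>x. x \<in> S \<Longrightarrow> 3 \<le> hops u x"
  shows "card S \<le> 2"
proof (rule ccontr)
  assume "\<not> card S \<le> 2"
  then obtain T where "T \<subseteq> S" "card T = 3"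
    by (metis obtain_subset_with_card_n not_less_eq_eq numeral_2_eq_2 numeral_3_eq_3)
  then obtain x y z where T: "T = {x, y, z}" "distinct [x, y, z]" by (auto simp: card_3_iff)
  have V: "x \<in> pverts G" "y \<in> pverts G" "z \<in> pverts G"
    and non: "(x, y) \<notin> parcs G" "(x, z) \<notin> parcs G" "(y, z) \<notin> parcs G"
    and f: "3 \<le> hops u x" "3 \<le> hops u y" "3 \<le> hops u z"
    using S \<open>T \<subseteq> S\<close> far T(1) unfolding independent_def by blast+
  \<comment> \<open>The edge of the forbidden subgraph joins \<open>u\<close> to the next vertex on
    a shortest path towards \<open>x\<close>. Everything adjacent to \<open>u\<close> or
    \<open>a\<close> is within distance 2 of \<open>u\<close>.\<close>
  obtain a where a: "a \<in> pverts G" "hops u a = 1"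
    using hops_between[of u x 1] u V f by auto
  have ua: "(u, a) \<in> parcs G" using hops_eq_1_iff u a by simp
  have uu: "hops u u = 0" using hops_eq_0_iff u by simp
  have "(u, w) \<notin> parcs G \<and> (a, w) \<notin> parcs G \<and> u \<noteq> w \<and> a \<noteq> w" if "3 \<le> hops u w" for w
    using hops_arc[OF u, of u w] hops_arc[OF u, of a w] that a uu by auto
  then have far: "(u, w) \<notin> parcs G" "(a, w) \<notin> parcs G" "u \<noteq> w" "a \<noteq> w" if "3 \<le> hops u w" for w
    using that by blast+
  have "\<exists>a b x y z. {a, b, x, y, z} \<subseteq> pverts G \<and> (a, b) \<in> parcs G \<and> distinct [a, b, x, y, z] \<and>
      {(a, x), (a, y), (a, z), (b, x), (b, y), (b, z), (x, y), (x, z), (y, z)} \<inter> parcs G = {}"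
    using u a(1) V ua T(2) far f non no_loops'[OF ua]
    by (intro exI[of _ u] exI[of _ a] exI[of _ x] exI[of _ y] exI[of _ z] conjI) simp_all
  with induced_free_P2_3P1_iff[OF pair_graph, THEN iffD1, OF free] show False by (rule notE)
qed

text \<open>Adjacent vertices lie on equal or consecutive levels from \<open>u\<close>. A distance
  of 7 or more would thus yield independent vertices on the levels 3, 5 and 7, all far from
  \<open>u\<close>.\<close>

lemma hops_le_6:
  assumes "u \<in> pverts G" "v \<in> pverts G"
  shows "hops u v \<le> 6"
proof (rule ccontr)
  assume "\<not> hops u v \<le> 6"
  then have "3 \<le> hops u v" "5 \<le> hops u v" "7 \<le> hops u v" by simp_all
  then obtain x y z where xyz: "x \<in> pverts G" "y \<in> pverts G" "z \<in> pverts G"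
    and h: "hops u x = 3" "hops u y = 5" "hops u z = 7"
    by (metis hops_between[OF assms])
  have "independent {x, y, z}"
    unfolding independent_def using xyz h no_loops' hops_arc[OF assms(1)] hops_arc_rev[OF assms(1)]
    by fastforce
  moreover have "x \<noteq> y" "x \<noteq> z" "y \<noteq> z" using h by auto
  ultimately show False using card_independent_far_le[OF assms(1), of "{x, y, z}"] h by fastforce
qed

lemma diam_le_6: "diam G \<le> 6"
  using diam_le_iff[of 6] hops_le_6 by simp

lemma diam_eq_6_iff: "diam G = 6 \<longleftrightarrow> (\<exists>u \<in> pverts G. \<exists>v \<in> pverts G. 6 \<le> hops u v)"
  using diam_eq_iff[of 6] hops_le_6 by (simp, metis antisym order_refl)

text \<open>If \<open>u\<close> and \<open>v\<close> are at distance \<open>6\<close>, then every vertex is far from one of them.\<close>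

lemma card_independent_le:
  assumes "u \<in> pverts G" "v \<in> pverts G" "6 \<le> hops u v" "independent S"
  shows "card S \<le> 4"
proof -
  let ?A = "{x \<in> S. 3 \<le> hops u x}" and ?B = "{x \<in> S. 3 \<le> hops v x}"
  \<comment> \<open>Otherwise \<open>hops u v\<close> would be at most 4.\<close>
  have "3 \<le> hops u x \<or> 3 \<le> hops v x" if "x \<in> S" for x
    using hops_triangle[of u x v] hops_sym[of x v] that assms unfolding independent_def by fastforce
  then have "S = ?A \<union> ?B" by blast
  then have "card S \<le> card ?A + card ?B" by (metis card_Un_le)
  moreover have "card ?A \<le> 2"
    using assms by (intro card_independent_far_le[of u]) (auto intro: independent_subset)
  moreover have "card ?B \<le> 2"
    using assms by (intro card_independent_far_le[of v]) (auto intro: independent_subset)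
  ultimately show ?thesis by simp
qed

text \<open>Two non-adjacent neighbours of \<open>u\<close>, together with the vertex on level 3 of
  a shortest path to \<open>v\<close>, would be three independent vertices at distance at least 3
  from \<open>v\<close>: the neighbours are at distance at least 5 from \<open>v\<close>, the third
  vertex at \<open>hops u v - 3\<close>.\<close>

lemma peripheral_simplicial:
  assumes uv: "u \<in> pverts G" "v \<in> pverts G" "6 \<le> hops u v"
    and xy: "(u, x) \<in> parcs G" "(u, y) \<in> parcs G" "x \<noteq> y"
  shows "(x, y) \<in> parcs G"
proof (rule ccontr)
  assume "(x, y) \<notin> parcs G"
  obtain z where z: "z \<in> pverts G" "hops u z = 3" "hops z v = hops u v - 3"
    using hops_between[of u v 3] uv by auto
  have V: "x \<in> pverts G" "y \<in> pverts G" using xy in_arcsD2 by auto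
  have ux: "hops u x = 1" "hops u y = 1" using hops_eq_1_iff uv V xy by auto
  have "independent {x, y, z}"
    unfolding independent_def
    using z V ux no_loops' hops_arc[OF uv(1)] hops_arc_rev[OF uv(1)] \<open>(x, y) \<notin> parcs G\<close>
      arcs_symmetric by fastforce
  moreover have "3 \<le> hops v w" if "w \<in> {x, y, z}" for w
    using that z V ux uv hops_triangle[of u x v] hops_triangle[of u y v] hops_sym[of v] by auto
  moreover have "x \<noteq> z" "y \<noteq> z" using ux z by auto
  ultimately show False using card_independent_far_le[OF uv(2), of "{x, y, z}"] xy(3) by simp
qed

text \<open>A simplicial vertex has minimal degree in its closed neighbourhood, and a neighbour of no
  larger degree is a true twin.\<close>

lemma peripheral_twin:
  assumes uv: "u \<in> pverts G" "v \<in> pverts G" "6 \<le> hops u v"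
    and w: "w \<in> pverts G" "hops u w \<le> 1"
    and deg: "card {x. (w, x) \<in> parcs G} \<le> card {x. (u, x) \<in> parcs G}"
  shows "6 \<le> hops w v"
proof (cases "w = u")
  case True then show ?thesis using uv by simp
next
  case False
  let ?N = "\<lambda>x. insert x {y. (x, y) \<in> parcs G}"
  have fin: "finite {y. (x, y) \<in> parcs G}" for x
    using pair_finite_verts by (rule finite_subset[rotated]) (auto dest: in_arcsD2)
  have uw: "(u, w) \<in> parcs G" using hops_le_1_iff uv w False by auto
  have "?N u \<subseteq> ?N w"
    using peripheral_simplicial[OF uv uw] arcs_symmetric[OF uw] by blast
  moreover have "card (?N w) \<le> card (?N u)"
    using deg fin no_loops' by (subst (1 2) card_insert_disjoint) auto
  ultimately have N: "?N w = ?N u" using fin by (metis card_seteq finite_insert)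
  \<comment> \<open>Take one step from \<open>w\<close> towards \<open>v\<close>. The vertex
    \<open>y\<close> reached lies in the common closed neighbourhood, so \<open>u\<close> is no
    farther from \<open>v\<close> than \<open>w\<close> is.\<close>
  have "hops w v \<noteq> 0"
    using hops_triangle[of u w v] w uv by auto
  then obtain y where y: "y \<in> pverts G" "hops w y = 1" "hops y v = hops w v - 1"
    using hops_between[of w v 1] w uv by auto
  have "y \<in> ?N u" using N y hops_eq_1_iff[of w y] w by blast
  then have "hops u y \<le> 1" using hops_le_1_iff[of u y] y uv by auto
  then show ?thesis using hops_triangle[of u y v] y uv \<open>hops w v \<noteq> 0\<close> by auto
qed

end

section \<open>The path with seven vertices and the value of \<open>d_max\<close>\<close>

definition P7 :: "nat pair_pre_digraph" where
  "P7 = \<lparr> pverts = {..<7}, parcs = {(i, j). i < 7 \<and> j < 7 \<and> (j = i + 1 \<or> i = j + 1)} \<rparr>"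

lemma pair_graph_P7: "pair_graph P7"
proof
  show "finite (parcs P7)"
    by (rule finite_subset[of _ "{..<7} \<times> {..<7}"]) (auto simp: P7_def)
  show "symmetric (with_proj P7)" by (auto simp: P7_def symmetric_def sym_def)
qed (auto simp: P7_def)

lemma connected_P7: "connected (with_proj P7)"
proof -
  interpret pair_graph P7 by (rule pair_graph_P7)
  have parcs: "parcs (mk_symmetric (with_proj P7)) = parcs P7"
    using arcs_symmetric by (auto simp: mk_symmetric_def)
  have pverts: "pverts (mk_symmetric (with_proj P7)) = pverts P7" by (simp add: mk_symmetric_def)
  have up: "0 \<rightarrow>\<^sup>*\<^bsub>with_proj P7\<^esub> i" if "i < 7" for i
    using that
  proof (induction i)
    case 0 show ?case by (rule reachable_refl) (simp add: P7_def)
  next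
    case (Suc i)
    then have "(i, Suc i) \<in> parcs P7" by (simp add: P7_def)
    with Suc show ?case by (auto intro: reachable_adj_trans)
  qed
  have "i \<rightarrow>\<^sup>*\<^bsub>with_proj P7\<^esub> 0" if "i < 7" for i
    using up[OF that] symmetric_reachable[OF sym_arcs] by blast
  with up have "i \<rightarrow>\<^sup>*\<^bsub>with_proj P7\<^esub> j" if "i < 7" "j < 7" for i j
    using that reachable_trans by blast
  then have "(i, j) \<in> rtrancl_on (pverts P7) (parcs P7)" if "i \<in> pverts P7" "j \<in> pverts P7" for i j
    using that by (simp add: reachable_def P7_def)
  moreover have "0 \<in> pverts P7" by (simp add: P7_def)
  ultimately show ?thesis
    unfolding connected_def strongly_connected_def reachable_def with_proj_simps parcs pverts by blast
qed

text \<open>Deleting an edge \<open>{c, c + 1}\<close> of the path and its neighbours leaves one or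
  two runs of consecutive vertices. For every position of the edge they hold at most two independent
  vertices in total.\<close>

lemma induced_free_P7: "induced_free P2_3P1 P7"
proof -
  have "\<not> (\<exists>a b x y z. {a, b, x, y, z} \<subseteq> pverts P7 \<and> (a, b) \<in> parcs P7 \<and> distinct [a, b, x, y, z] \<and>
      {(a, x), (a, y), (a, z), (b, x), (b, y), (b, z), (x, y), (x, z), (y, z)} \<inter> parcs P7 = {})"
  proof (intro notI, elim exE conjE)
    fix a b x y z
    assume *: "{a, b, x, y, z} \<subseteq> pverts P7" "(a, b) \<in> parcs P7" "distinct [a, b, x, y, z]"
      "{(a, x), (a, y), (a, z), (b, x), (b, y), (b, z), (x, y), (x, z), (y, z)} \<inter> parcs P7 = {}"
    have gap: "i + 2 \<le> j \<or> j + 2 \<le> i"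
      if "i \<in> pverts P7" "j \<in> pverts P7" "i \<noteq> j" "(i, j) \<notin> parcs P7" for i j
      using that by (simp add: P7_def) linarith
    define c where "c = min a b"
    have c: "a = c \<and> b = c + 1 \<or> b = c \<and> a = c + 1"
      using *(2) by (auto simp: P7_def c_def)
    have out: "w + 2 \<le> c \<or> c + 3 \<le> w"
      if "w \<in> pverts P7" "a \<noteq> w" "b \<noteq> w" "(a, w) \<notin> parcs P7" "(b, w) \<notin> parcs P7" for w
      using gap[of a w] gap[of b w] that *(1) c by auto
    have "x + 2 \<le> c \<or> c + 3 \<le> x" "y + 2 \<le> c \<or> c + 3 \<le> y" "z + 2 \<le> c \<or> c + 3 \<le> z"
      using * by (intro out; simp)+
    moreover have "x + 2 \<le> y \<or> y + 2 \<le> x" "x + 2 \<le> z \<or> z + 2 \<le> x" "y + 2 \<le> z \<or> z + 2 \<le> y"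
      using * by (intro gap; simp)+
    moreover have "c + 1 < 7" "x < 7" "y < 7" "z < 7" using *(1) c by (auto simp: P7_def)
    ultimately show False by presburger
  qed
  then show ?thesis using induced_free_P2_3P1_iff[OF pair_graph_P7] by (rule iffD2[rotated])
qed

lemma diam_P7: "diam P7 = 6"
proof -
  interpret connected_P2_3P1_free_graph P7
    using pair_graph_P7 connected_P7 induced_free_P7
    by (simp add: connected_P2_3P1_free_graph_def connected_P2_3P1_free_graph_axioms_def
        connected_pair_graph_def connected_pair_graph_axioms_def)
  \<comment> \<open>An arc raises the vertex number by at most 1, so 6 is at distance at least 6
    from 0.\<close>
  have "j \<le> k" if "(0, j) \<in> parcs P7 ^^ k" for j k
    using that
  proof (induction k arbitrary: j)
    case (Suc k)
    then obtain i where "(0, i) \<in> parcs P7 ^^ k" "(i, j) \<in> parcs P7" by auto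
    with Suc.IH[of i] show ?case by (auto simp: P7_def)
  qed simp
  then have "6 \<le> hops 0 6" using relpow_hops[of 0 6] by (simp add: P7_def)
  then show ?thesis unfolding diam_eq_6_iff by (intro bexI[of _ 0] bexI[of _ 6]) (auto simp: P7_def)
qed

lemma d_max_connected_P2_3P1_free: "d_max connected_P2_3P1_free = 6"
  unfolding d_max_def
proof (rule Sup_eqI)
  fix d assume "d \<in> {diam G | G. pair_graph G \<and> connected_P2_3P1_free G}"
  then obtain G where G: "d = diam G" "pair_graph G" "connected_P2_3P1_free G" by blast
  then interpret connected_P2_3P1_free_graph G
    by (simp add: connected_P2_3P1_free_graph_def connected_P2_3P1_free_graph_axioms_def
        connected_pair_graph_def connected_pair_graph_axioms_def connected_P2_3P1_free_def)
  show "d \<le> 6" using G diam_le_6 by simp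
next
  fix d assume "\<And>e. e \<in> {diam G | G. pair_graph G \<and> connected_P2_3P1_free G} \<Longrightarrow> e \<le> d"
  moreover have "6 \<in> {diam G | G. pair_graph G \<and> connected_P2_3P1_free G}"
    using diam_P7 pair_graph_P7 connected_P7 induced_free_P7
    by (auto simp: connected_P2_3P1_free_def intro!: exI[of _ P7])
  ultimately show "6 \<le> d" by blast
qed

section \<open>The program\<close>

definition wp :: "nat \<Rightarrow> prog \<Rightarrow> (nat \<Rightarrow> (reg \<Rightarrow> nat) \<Rightarrow> (nat \<Rightarrow> nat) \<Rightarrow> bool) \<Rightarrow>
    (reg \<Rightarrow> nat) \<Rightarrow> (nat \<Rightarrow> nat) \<Rightarrow> bool" where
  "wp B p Q R M \<longleftrightarrow> (\<exists>t R' M'. exec B p (R, M) t (R', M') \<and> Q t R' M')"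

lemma wp_mono:
  assumes "wp B p Q R M" and "\<And>t R M. Q t R M \<Longrightarrow> Q' t R M"
  shows "wp B p Q' R M"
  using assms unfolding wp_def by blast

lemma wp_Const: "n < B \<Longrightarrow> Q 1 (R(i := n)) M \<Longrightarrow> wp B (Const i n) Q R M"
  and wp_Move: "Q 1 (R(i := R j)) M \<Longrightarrow> wp B (Move i j) Q R M"
  and wp_Add: "R j + R k < B \<Longrightarrow> Q 1 (R(i := R j + R k)) M \<Longrightarrow> wp B (Add i j k) Q R M"
  and wp_Sub: "Q 1 (R(i := R j - R k)) M \<Longrightarrow> wp B (Sub i j k) Q R M"
  and wp_Load: "M (R a) < B \<Longrightarrow> Q 1 (R(i := M (R a))) M \<Longrightarrow> wp B (Load i a) Q R M"
  and wp_Store: "Q 1 R (M(R a := R i)) \<Longrightarrow> wp B (Store a i) Q R M"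
  unfolding wp_def by (blast intro: exec.intros)+

text \<open>The postcondition sees the running time, so that of the second program is shifted by the
  time \<open>t\<close> already spent.\<close>

lemma wp_Seq: "wp B p (\<lambda>t. wp B q (\<lambda>u. Q (t + u))) R M \<Longrightarrow> wp B (Seq p q) Q R M"
  unfolding wp_def by (blast intro: exec.intros)

lemma wp_Seq_mono:
  assumes "wp B p P R M" "\<And>t R M. P t R M \<Longrightarrow> wp B q (\<lambda>u. Q (t + u)) R M"
  shows "wp B (Seq p q) Q R M"
  using assms by (intro wp_Seq) (rule wp_mono)

lemma wp_If:
  assumes "holds b R \<Longrightarrow> wp B p (\<lambda>t. Q (1 + t)) R M"
    and "\<not> holds b R \<Longrightarrow> wp B q (\<lambda>t. Q (1 + t)) R M"
  shows "wp B (If b p q) Q R M"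
proof (cases "holds b R")
  case True
  with assms(1) show ?thesis unfolding wp_def by (fastforce intro: exec.IfTrue)
next
  case False
  with assms(2) show ?thesis unfolding wp_def by (fastforce intro: exec.IfFalse)
qed

lemmas wp_intros = wp_Const wp_Move wp_Add wp_Sub wp_Load wp_Store wp_Seq wp_If

text \<open>For loops whose number \<open>n\<close> of iterations is known beforehand. Each
  iteration has its own bound \<open>T i\<close>, so costs proportional to degrees can be summed
  over the vertices. Every \<open>+ 1\<close> pays for one test, the last for the failing one. Since
  \<open>While\<close> unfolds at its first iteration, the induction runs from \<open>n\<close> down
  to \<open>j\<close>.\<close>

lemma wp_While_count:
  assumes init: "I 0 R M"
    and step: "\<And>i R M. i < n \<Longrightarrow> I i R M \<Longrightarrow>
      holds b R \<and> wp B p (\<lambda>t R M. t \<le> T i \<and> I (Suc i) R M) R M"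
    and stop: "\<And>R M. I n R M \<Longrightarrow> \<not> holds b R"
  shows "wp B (While b p) (\<lambda>t R M. t \<le> (\<Sum>i<n. T i + 1) + 1 \<and> I n R M) R M"
proof -
  have "wp B (While b p) (\<lambda>t R M. t \<le> (\<Sum>i = j..<n. T i + 1) + 1 \<and> I n R M) R M"
    if "j \<le> n" "I j R M" for j R M
    using that
  proof (induction j arbitrary: R M rule: inc_induct)
    case base
    with stop show ?case unfolding wp_def by (fastforce intro: exec.WhileFalse)
  next
    case (step j)
    from assms(2)[OF step(2,4)] obtain t R' M' where
      b: "holds b R" and body: "exec B p (R, M) t (R', M')" "t \<le> T j" "I (Suc j) R' M'"
      unfolding wp_def by blast
    from step(3)[OF body(3)] obtain u R'' M'' where
      rest: "exec B (While b p) (R', M') u (R'', M'')" "u \<le> (\<Sum>i = Suc j..<n. T i + 1) + 1"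
        "I n R'' M''"
      unfolding wp_def by blast
    have "exec B (While b p) (R, M) (1 + t + u) (R'', M'')"
      using b body(1) rest(1) by (intro exec.WhileTrue) simp_all
    moreover have "1 + t + u \<le> (\<Sum>i = j..<n. T i + 1) + 1"
      using body(2) rest(2) step(2) by (simp add: sum.atLeast_Suc_lessThan)
    ultimately show ?case unfolding wp_def using rest(3) by blast
  qed
  from this[of 0] init show ?thesis by (simp add: atLeast0LessThan)
qed

text \<open>Registers: \<open>0\<close> answer, \<open>1\<close> the constant \<open>1\<close>, \<open>2\<close> the number \<open>n\<close> of vertices, \<open>3\<close> the base
  address of the label array (the first free cell), \<open>4\<close> the base address of the array of marks,
  \<open>5\<close> the picked vertex, \<open>6\<close> its degree, \<open>7\<close> the vertex of the current loop, \<open>8\<close> and \<open>9\<close> the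
  current and the final position in an adjacency list, \<open>10\<close> the largest label, \<open>12\<close> the next label,
  \<open>13\<close> the constant \<open>0\<close>, \<open>11\<close> and \<open>14\<close> temporaries.\<close>

abbreviation skip :: prog where
  "skip \<equiv> Move 14 14"

definition for_verts :: "prog \<Rightarrow> prog" where
  "for_verts p = Seq (Const 7 0) (While (Less 7 2) (Seq p (Add 7 7 1)))"

text \<open>Register 13 is never written and remains 0, so it also addresses cell 0, which holds
  \<open>n\<close>. Cell \<open>n + 1\<close> holds the first free address, where the labels start;
  the marks follow \<open>n\<close> cells later.\<close>

definition prog_init :: prog where
  "prog_init = Seq (Const 1 1) (Seq (Load 2 13) (Seq (Add 11 2 1) (Seq (Load 3 11) (Add 4 3 2))))"

definition load_list :: prog where
  "load_list = Seq (Add 11 7 1) (Seq (Load 8 11) (Seq (Add 11 11 1) (Load 9 11)))"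

text \<open>Register 6 starts at \<open>n\<close>, above every degree, so the first unmarked vertex
  is always taken. If all vertices are marked, the previous pick stays in register 5.\<close>

definition prog_pick :: prog where
  "prog_pick = Seq (Move 6 2) (for_verts
    (Seq (Add 11 4 7) (Seq (Load 11 11) (If (Eq 11 13)
      (Seq load_list (Seq (Sub 11 9 8) (If (Less 11 6) (Seq (Move 6 11) (Move 5 7)) skip)))
      skip))))"

definition prog_clear :: prog where
  "prog_clear = for_verts (Seq (Add 11 3 7) (Store 11 13))"

definition prog_source :: prog where
  "prog_source = Seq (Add 11 3 5) (Seq (Store 11 1) (Move 10 1))"

definition prog_scan :: prog where
  "prog_scan = While (Less 8 9) (Seq (Load 11 8) (Seq (Add 11 11 3) (Seq (Load 14 11)
    (Seq (If (Eq 14 13) (Store 11 12) skip) (Add 8 8 1)))))"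

text \<open>One level of breadth-first search without a queue; label 0 means unvisited. The test
  \<open>Leq 11 10\<close> keeps vertices labelled during this very pass from being expanded in it.
  Rescanning all older vertices is affordable because the number of passes is constant.\<close>

definition prog_expand :: prog where
  "prog_expand = Seq (Add 12 10 1) (Seq (for_verts
    (Seq (Add 11 3 7) (Seq (Load 11 11)
      (If (Neq 11 13) (If (Leq 11 10) (Seq load_list prog_scan) skip) skip))))
    (Move 10 12))"

definition prog_mark :: prog where
  "prog_mark = for_verts (Seq (Add 11 3 7) (Seq (Load 11 11)
    (If (Neq 11 13) (Seq (Add 11 4 7) (Store 11 1)) skip)))"

definition prog_check :: prog where
  "prog_check = for_verts (Seq (Add 11 3 7) (Seq (Load 11 11) (If (Eq 11 13) (Move 0 1) skip)))"

text \<open>Marking follows the first expansion, when exactly the closed neighbourhood of the pick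
  is labelled. Four more expansions reach radius 5, so a vertex still unlabelled is at distance at
  least 6.\<close>

definition prog_round :: prog where
  "prog_round = Seq prog_pick (Seq prog_clear (Seq prog_source (Seq prog_expand (Seq prog_mark
    (Seq prog_expand (Seq prog_expand (Seq prog_expand (Seq prog_expand prog_check))))))))"

definition prog_diam6 :: prog where
  "prog_diam6 = Seq prog_init (Seq prog_round (Seq prog_round (Seq prog_round prog_round)))"

text \<open>\<open>B\<close> is the word bound. It leaves room for all addresses of the input and of
  two arrays of length \<open>n\<close>, and the summand 8 exceeds every label.\<close>

locale ram_graph = pair_graph G for G :: "nat pair_pre_digraph" +
  fixes adj :: "nat list list" and B :: nat
  assumes adj: "adjacency_lists G adj"
    and nonempty: "adj \<noteq> []"
    and word: "length (input_cells adj) + 2 * length adj + 8 \<le> B"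
begin

section \<open>The input in memory and sums of degrees\<close>

definition n :: nat where "n = length adj"
definition N :: nat where "N = length (input_cells adj)"
definition off :: "nat \<Rightarrow> nat" where "off v = n + 2 + length (concat (take v adj))"
definition deg :: "nat \<Rightarrow> nat" where "deg v = length (adj ! v)"

lemma n_pos: "0 < n" using nonempty by (simp add: n_def)

lemma pverts_eq: "pverts G = {..<n}"
  using adj by (simp add: adjacency_lists_def n_def)

lemma set_adj: "v < n \<Longrightarrow> set (adj ! v) = {w. (v, w) \<in> parcs G}"
  using adj by (simp add: adjacency_lists_def n_def)

lemma adj_nth_less: "v < n \<Longrightarrow> j < deg v \<Longrightarrow> adj ! v ! j < n"
  using set_adj[of v] nth_mem[of j "adj ! v"] in_arcsD2 pverts_eq by (auto simp: deg_def)

lemma deg_eq_card: "v < n \<Longrightarrow> deg v = card {w. (v, w) \<in> parcs G}"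
  using adj distinct_card[of "adj ! v"] set_adj[of v]
  by (simp add: adjacency_lists_def n_def deg_def)

lemma deg_less: 
  assumes "v < n" shows "deg v < n"
proof -
  have "{w. (v, w) \<in> parcs G} \<subseteq> {..<n} - {v}"
    using in_arcsD2 pverts_eq no_loops'[of v v] by auto
  then have "deg v \<le> card ({..<n} - {v})"
    unfolding deg_eq_card[OF assms] by (intro card_mono) auto
  with assms show ?thesis by simp
qed

lemma off_Suc: "v < n \<Longrightarrow> off (Suc v) = off v + deg v"
  by (simp add: off_def deg_def n_def take_Suc_conv_app_nth)

lemma N_eq: "N = off n" "N = n + 2 + length (concat adj)"
  by (simp_all add: N_def input_cells_def off_def n_def)

lemma sum_deg: "(\<Sum>v<n. deg v) = length (concat adj)"
  by (simp add: n_def deg_def length_concat sum_list_sum_nth atLeast0LessThan)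

text \<open>Converts the total length of the lists into a bound in the number of edges: the arcs
  split into increasing and decreasing pairs, and each half injects into the edge set.\<close>

lemma length_concat_adj_le: "length (concat adj) \<le> 2 * num_edges G"
proof -
  let ?E = "{{u, v} | u v. (u, v) \<in> parcs G}"
  let ?A = "{(u, v). (u, v) \<in> parcs G \<and> u < v}" and ?A' = "{(u, v). (u, v) \<in> parcs G \<and> v < u}"
  have "finite ?E"
    by (rule finite_subset[of _ "(\<lambda>(u, v). {u, v}) ` parcs G"]) (auto simp: pair_finite_arcs)
  then have "card ?A \<le> card ?E" "card ?A' \<le> card ?E"
    by (intro card_inj_on_le[of "\<lambda>(u, v). {u, v}"]; force simp: inj_on_def doubleton_eq_iff)+
  moreover have "card (parcs G) \<le> card ?A + card ?A'"
  proof -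
    have "finite ?A" "finite ?A'" by (rule finite_subset[OF _ pair_finite_arcs]; blast)+
    moreover have "parcs G \<subseteq> ?A \<union> ?A'" using no_loops' by force
    ultimately have "card (parcs G) \<le> card (?A \<union> ?A')" by (intro card_mono) simp_all
    also have "\<dots> \<le> card ?A + card ?A'" by (rule card_Un_le)
    finally show ?thesis .
  qed
  moreover have "card (parcs G) = length (concat adj)"
  proof -
    have "parcs G = Sigma {..<n} (\<lambda>v. {w. (v, w) \<in> parcs G})"
      using in_arcsD1 pverts_eq by auto
    then have "card (parcs G) = card (Sigma {..<n} (\<lambda>v. {w. (v, w) \<in> parcs G}))" by (rule arg_cong)
    also have "\<dots> = (\<Sum>v<n. card {w. (v, w) \<in> parcs G})"
      by (rule card_SigmaI) (simp_all flip: set_adj)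
    also have "\<dots> = length (concat adj)"
      by (simp add: deg_eq_card flip: sum_deg)
    finally show ?thesis .
  qed
  ultimately show ?thesis unfolding num_edges_def by linarith
qed

lemma off_le: "v \<le> n \<Longrightarrow> off v \<le> N"
  by (induction rule: inc_induct) (simp_all add: N_eq off_Suc)

lemma cell_0: "input_cells adj ! 0 = n"
  by (simp add: input_cells_def n_def)

lemma cell_off: "v \<le> n \<Longrightarrow> input_cells adj ! Suc v = off v"
  by (auto simp: input_cells_def nth_append off_def n_def simp del: upt_Suc)

lemma cell_adj:
  assumes "v < n" "j < deg v"
  shows "input_cells adj ! (off v + j) = adj ! v ! j"
proof -
  have "concat adj = concat (take v adj) @ adj ! v @ concat (drop (Suc v) adj)"
    using assms(1) id_take_nth_drop[of v adj] by (metis concat.simps(2) concat_append n_def)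
  with assms show ?thesis
    by (simp add: input_cells_def nth_append off_def n_def deg_def del: upt_Suc)
qed

section \<open>The state invariant and the verification of the program parts\<close>

lemma word': "N + 2 * n + 8 \<le> B" using word by (simp add: N_def n_def)

text \<open>The parameters are the answer \<open>a\<close>, the pick \<open>w\<close>, the marked
  set \<open>U\<close>, the labels \<open>x\<close> and the largest label \<open>k\<close>. The
  registers left out are scratch. Only the values of \<open>x\<close> and \<open>U\<close> below
  \<open>n\<close> matter, hence \<open>state_inv_cong\<close>.\<close>

definition state_inv ::
  "nat \<Rightarrow> nat \<Rightarrow> nat set \<Rightarrow> (nat \<Rightarrow> nat) \<Rightarrow> nat \<Rightarrow> (reg \<Rightarrow> nat) \<Rightarrow> (nat \<Rightarrow> nat) \<Rightarrow> bool" where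
  "state_inv a w U x k R M \<longleftrightarrow>
    R 0 = a \<and> R 1 = 1 \<and> R 2 = n \<and> R 3 = N \<and> R 4 = N + n \<and> R 5 = w \<and> R 10 = k \<and> R 13 = 0 \<and>
    (\<forall>c<N. M c = input_cells adj ! c) \<and> (\<forall>v<n. M (N + v) = x v) \<and>
    (\<forall>v<n. M (N + n + v) = of_bool (v \<in> U))"

lemma state_inv_update [simp]:
  "i \<notin> {0, 1, 2, 3, 4, 5, 10, 13} \<Longrightarrow>
    state_inv a w U x k (R(i := y)) M = state_inv a w U x k R M"
  unfolding state_inv_def by auto

lemma state_invD:
  assumes "state_inv a w U x k R M"
  shows "R 0 = a" "R 1 = 1" "R (Suc 0) = 1" "R 2 = n" "R 3 = N" "R 4 = N + n" "R 5 = w" "R 10 = k"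
    "R 13 = 0" "\<And>v. v < n \<Longrightarrow> M (N + v) = x v" "\<And>v. v < n \<Longrightarrow> M (N + n + v) = of_bool (v \<in> U)"
    "\<And>v. v \<le> n \<Longrightarrow> M (Suc v) = off v"
    "\<And>v j. v < n \<Longrightarrow> j < deg v \<Longrightarrow> M (off v + j) = adj ! v ! j"
proof -
  fix v assume "v \<le> n"
  then show "M (Suc v) = off v" using assms cell_off N_eq(2) by (simp add: state_inv_def)
next
  fix v j assume vj: "v < n" "j < deg v"
  then have "off v + j < N" using off_le[of "Suc v"] off_Suc[of v] by simp
  with vj show "M (off v + j) = adj ! v ! j" using assms cell_adj by (simp add: state_inv_def)
qed (use assms in \<open>simp_all add: state_inv_def\<close>)

lemma state_inv_label:
  assumes "state_inv a w U x k R M" "v < n"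
  shows "state_inv a w U (x(v := y)) k R (M(N + v := y))"
  using assms unfolding state_inv_def by auto

lemma state_inv_mark:
  assumes "state_inv a w U x k R M" "v < n"
  shows "state_inv a w (insert v U) x k R (M(N + n + v := 1))"
  using assms unfolding state_inv_def by auto

lemma state_inv_cong:
  assumes "state_inv a w U x k R M" "\<And>v. v < n \<Longrightarrow> x v = y v" "\<And>v. v < n \<Longrightarrow> v \<in> U \<longleftrightarrow> v \<in> V"
  shows "state_inv a w V y k R M"
  using assms unfolding state_inv_def by auto

text \<open>The counter is incremented after the body, so the body must establish the next invariant
  for register 7 set to \<open>Suc i\<close>. The summand 2 per vertex is test and increment; the
  final 2 is the initialisation and the failing test.\<close>

lemma wp_for_verts:
  assumes init: "I 0 (R(7 := 0)) M"
    and regs: "\<And>i R M. I i R M \<Longrightarrow> R 1 = 1 \<and> R 2 = n"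
    and body: "\<And>i R M. i < n \<Longrightarrow> R 7 = i \<Longrightarrow> I i R M \<Longrightarrow>
      wp B p (\<lambda>t R M. t \<le> T i \<and> R 7 = i \<and> R 1 = 1 \<and> I (Suc i) (R(7 := Suc i)) M) R M"
  shows "wp B (for_verts p) (\<lambda>t R M. t \<le> (\<Sum>i<n. T i + 2) + 2 \<and> I n R M) R M"
proof -
  let ?J = "\<lambda>i R M. R 7 = i \<and> I i R M"
  have "wp B (While (Less 7 2) (Seq p (Add 7 7 1)))
      (\<lambda>t R M. t \<le> (\<Sum>i<n. (T i + 1) + 1) + 1 \<and> ?J n R M) (R(7 := 0)) M"
  proof (rule wp_While_count[where I = ?J])
    fix i R M assume i: "i < n" "?J i R M"
    have "wp B (Seq p (Add 7 7 1)) (\<lambda>t R M. t \<le> T i + 1 \<and> ?J (Suc i) R M) R M"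
      using word' i by (intro wp_Seq wp_mono[OF body[of i R M]] wp_Add) simp_all
    with i regs[of i R M] show "holds (Less 7 2) R \<and>
        wp B (Seq p (Add 7 7 1)) (\<lambda>t R M. t \<le> T i + 1 \<and> ?J (Suc i) R M) R M" by simp
  next
    show "\<not> holds (Less 7 2) R" if "?J n R M" for R M
      using regs[of n R M] that by simp
  qed (use init in auto)
  then have "wp B (While (Less 7 2) (Seq p (Add 7 7 1)))
      (\<lambda>t R M. 1 + t \<le> (\<Sum>i<n. T i + 2) + 2 \<and> I n R M) (R(7 := 0)) M"
    by (rule wp_mono) simp
  then show ?thesis
    unfolding for_verts_def using word' by (intro wp_Seq wp_Const) simp_all
qed

lemma wp_load_list:
  assumes "state_inv a w U x k R M" "R 7 = v" "v < n"
  shows "wp B load_list (\<lambda>t R' M'. t = 4 \<and> M' = M \<and>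
    R' = R(11 := v + 2, 8 := off v, 9 := off (Suc v))) R M"
  unfolding load_list_def
  using assms(2,3) state_invD[OF assms(1)] word' off_le[of v] off_le[of "Suc v"]
  by (intro wp_intros) (auto simp: fun_upd_def)

lemma wp_clear:
  assumes "state_inv a w U x k R M"
  shows "wp B prog_clear (\<lambda>t R M. t \<le> 4 * n + 2 \<and> state_inv a w U (\<lambda>_. 0) k R M) R M"
proof -
  have "wp B prog_clear (\<lambda>t R M. t \<le> (\<Sum>i<n. 2 + 2) + 2 \<and>
      state_inv a w U (\<lambda>v. if v < n then 0 else x v) k R M) R M"
    unfolding prog_clear_def
  proof (rule wp_for_verts)
    fix i R M
    assume i: "i < n" "R 7 = i" and inv: "state_inv a w U (\<lambda>v. if v < i then 0 else x v) k R M"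
    have "state_inv a w U (\<lambda>v. if v < Suc i then 0 else x v) k R (M(N + i := 0))"
      by (rule state_inv_cong[OF state_inv_label[OF inv i(1)]]) auto
    then show "wp B (Seq (Add 11 3 7) (Store 11 13)) (\<lambda>t R M. t \<le> 2 \<and> R 7 = i \<and> R 1 = 1 \<and>
        state_inv a w U (\<lambda>v. if v < Suc i then 0 else x v) k (R(7 := Suc i)) M) R M"
      using i state_invD[OF inv] word' by (intro wp_intros) auto
  qed (use assms in \<open>auto simp: state_inv_def\<close>)
  then show ?thesis by (rule wp_mono) (auto elim: state_inv_cong)
qed

lemma state_inv_reg:
  assumes "state_inv a w U x k R M"
  shows "state_inv b w U x k (R(0 := b)) M" "state_inv a v U x k (R(5 := v)) M"
    "state_inv a w U x l (R(10 := l)) M"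
  using assms unfolding state_inv_def by auto

lemma wp_pick:
  assumes inv: "state_inv a w0 U x k R M" and w0: "w0 < n"
  shows "wp B prog_pick (\<lambda>t R M. t \<le> 13 * n + 3 \<and>
    (\<exists>w<n. (\<forall>u<n. u \<notin> U \<longrightarrow> w \<notin> U \<and> deg w \<le> deg u) \<and> state_inv a w U x k R M)) R M"
proof -
  \<comment> \<open>\<open>d = n\<close> encodes that no unmarked vertex has been met, as degrees
    are below \<open>n\<close>. At the end an unmarked \<open>u\<close> forces \<open>d\<close> down
    to at most \<open>deg u\<close>, so \<open>w\<close> is a genuine candidate.\<close>
  define best where "best i w d \<longleftrightarrow>
    w < n \<and> d \<le> n \<and> (d < n \<longrightarrow> w \<notin> U \<and> d = deg w) \<and> (\<forall>u<i. u \<notin> U \<longrightarrow> d \<le> deg u)" for i w d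
  let ?I = "\<lambda>i R M. \<exists>w. best i w (R 6) \<and> state_inv a w U x k R M"
  let ?body = "Seq (Add 11 4 7) (Seq (Load 11 11) (If (Eq 11 13)
      (Seq load_list (Seq (Sub 11 9 8) (If (Less 11 6) (Seq (Move 6 11) (Move 5 7)) skip))) skip))"
  have "wp B (for_verts ?body) (\<lambda>t R M. t \<le> (\<Sum>i<n. 11 + 2) + 2 \<and> ?I n R M) (R(6 := n)) M"
  proof (rule wp_for_verts)
    show "?I 0 (R(6 := n, 7 := 0)) M"
      using inv w0 by (intro exI[of _ w0]) (simp add: best_def)
  next
    fix i R M
    assume i: "i < n" "R 7 = i" and "?I i R M"
    then obtain w where best: "best i w (R 6)" and inv: "state_inv a w U x k R M" by blast
    note D = state_invD[OF inv]
    have old: "best (Suc i) w (R 6)" if "i \<in> U \<or> R 6 \<le> deg i"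
      using that best by (auto simp: best_def less_Suc_eq)
    have new: "best (Suc i) i (deg i)" if "i \<notin> U" "deg i < R 6"
      using that best i deg_less[of i] unfolding best_def by (fastforce simp: less_Suc_eq)
    have cells: "M (Suc i) = off i" "M (Suc (Suc i)) = off i + deg i" "M (N + n + i) = of_bool (i \<in> U)"
      using D i off_Suc by simp_all
    have bounds: "off i + deg i < B" "Suc (Suc i) < B" "N + n + i < B"
      using off_le[of "Suc i"] off_Suc[of i] word' i by simp_all
    show "wp B ?body (\<lambda>t R M. t \<le> 11 \<and> R 7 = i \<and> R 1 = 1 \<and> ?I (Suc i) (R(7 := Suc i)) M) R M"
    proof (cases "i \<in> U")
      case True
      then have "?I (Suc i) R M" using old inv by blast
      with True show ?thesis
        using D i cells bounds by (intro wp_intros) simp_all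
    next
      case False
      show ?thesis
      proof (cases "deg i < R 6")
        case True
        then have "best (Suc i) i (deg i)" using new False by blast
        with True False show ?thesis
          unfolding load_list_def using D i cells bounds inv
          by (intro wp_intros)
            (simp_all, intro exI[of _ i] conjI state_inv_reg(2)[where w = w], simp_all)
      next
        case False
        with \<open>i \<notin> U\<close> old inv have "best (Suc i) w (R 6) \<and> state_inv a w U x k R M" by simp
        with False \<open>i \<notin> U\<close> show ?thesis
          unfolding load_list_def using D i cells bounds
          by (intro wp_intros) auto
      qed
    qed
  qed (auto simp: state_inv_def)
  moreover have "\<forall>u<n. u \<notin> U \<longrightarrow> w \<notin> U \<and> deg w \<le> deg u" if "best n w d" for w d
    using that deg_less unfolding best_def by (metis le_less_trans)
  moreover have "w < n" if "best n w d" for w d using that by (simp add: best_def)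
  ultimately have "wp B (for_verts ?body) (\<lambda>t R M. 1 + t \<le> 13 * n + 3 \<and>
      (\<exists>w<n. (\<forall>u<n. u \<notin> U \<longrightarrow> w \<notin> U \<and> deg w \<le> deg u) \<and> state_inv a w U x k R M)) (R(6 := n)) M"
    by (elim wp_mono) fastforce
  then show ?thesis
    unfolding prog_pick_def using state_invD[OF inv] by (intro wp_Seq wp_Move) simp
qed

lemma wp_source:
  assumes inv: "state_inv a w U x k R M" and "w < n"
  shows "wp B prog_source (\<lambda>t R M. t = 3 \<and> state_inv a w U (x(w := 1)) 1 R M) R M"
  unfolding prog_source_def
  using state_invD[OF inv] word' assms(2) state_inv_label[OF inv, of w 1]
  by (intro wp_intros) (auto intro!: state_inv_reg(3))

lemma wp_scan:
  assumes inv: "state_inv a w U x k R M" and v: "v < n" "R 8 = off v" "R 9 = off (Suc v)"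
    and l: "R 12 = l" "l < B" and x: "\<And>z. z < n \<Longrightarrow> x z < B"
  shows "wp B prog_scan (\<lambda>t R' M'. t \<le> 7 * deg v + 1 \<and> R' 7 = R 7 \<and> R' 12 = l \<and>
    state_inv a w U (\<lambda>z. if x z = 0 \<and> z \<in> set (adj ! v) then l else x z) k R' M') R M"
proof -
  define y where "y j = (\<lambda>z. if x z = 0 \<and> z \<in> set (take j (adj ! v)) then l else x z)" for j
  let ?I = "\<lambda>j R' M'. R' 7 = R 7 \<and> R' 8 = off v + j \<and> R' 9 = off (Suc v) \<and> R' 12 = l \<and>
    state_inv a w U (y j) k R' M'"
  have "wp B prog_scan (\<lambda>t R' M'. t \<le> (\<Sum>j<deg v. 6 + 1) + 1 \<and> ?I (deg v) R' M') R M"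
    unfolding prog_scan_def
  proof (rule wp_While_count)
    show "?I 0 R M" using inv v l by (simp add: y_def)
  next
    fix j R' M'
    assume j: "j < deg v" and I: "?I j R' M'"
    then have inv: "state_inv a w U (y j) k R' M'" by blast
    define z where "z = adj ! v ! j"
    have z: "z < n" using adj_nth_less v j by (simp add: z_def)
    have take: "set (take (Suc j) (adj ! v)) = insert z (set (take j (adj ! v)))"
      using j by (simp add: z_def deg_def take_Suc_conv_app_nth)
    have stored: "state_inv a w U (y (Suc j)) k R' (M'(N + z := l))" if "y j z = 0"
      by (rule state_inv_cong[OF state_inv_label[OF inv z]])
        (use that in \<open>auto simp: y_def take split: if_splits\<close>)
    have kept: "state_inv a w U (y (Suc j)) k R' M'" if "y j z \<noteq> 0"
      by (rule state_inv_cong[OF inv]) (use that in \<open>auto simp: y_def take split: if_splits\<close>)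
    have cells: "M' (off v + j) = z" "M' (N + z) = y j z"
      using state_invD[OF inv] v j z by (auto simp: z_def)
    have bounds: "z < B" "N + z < B" "Suc (off v + j) < B" "y j z < B"
      using off_le[of "Suc v"] off_Suc[of v] word' v j z x l by (auto simp: y_def)
    have "wp B (Seq (Load 11 8) (Seq (Add 11 11 3) (Seq (Load 14 11)
        (Seq (If (Eq 14 13) (Store 11 12) skip) (Add 8 8 1)))))
        (\<lambda>t R' M'. t \<le> 6 \<and> ?I (Suc j) R' M') R' M'"
      using I state_invD[OF inv] cells bounds stored kept
      by (intro wp_intros) (auto simp: add.commute)
    with I j off_Suc[of v] v show "holds (Less 8 9) R' \<and> wp B (Seq (Load 11 8) (Seq (Add 11 11 3)
        (Seq (Load 14 11) (Seq (If (Eq 14 13) (Store 11 12) skip) (Add 8 8 1)))))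
        (\<lambda>t R' M'. t \<le> 6 \<and> ?I (Suc j) R' M') R' M'"
      by simp
  qed (use v off_Suc[of v] in simp)
  then show ?thesis by (rule wp_mono) (simp add: y_def deg_def)
qed

text \<open>The new label \<open>k + 1\<close> exceeds \<open>k\<close>, so which vertices get
  expanded depends only on the labels \<open>x\<close> from before the pass. A vertex costs a
  constant plus \<open>7 * deg i\<close>, which sums to linear time.\<close>

lemma wp_expand:
  assumes inv: "state_inv a w U x k R M" and k: "k \<le> 6" and x: "\<And>v. v < n \<Longrightarrow> x v \<le> k"
  shows "wp B prog_expand (\<lambda>t R M. t \<le> 11 * n + 7 * length (concat adj) + 4 \<and>
    state_inv a w U (\<lambda>z. if x z = 0 \<and> (\<exists>v<n. x v \<noteq> 0 \<and> (v, z) \<in> parcs G) then k + 1 else x z)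
      (k + 1) R M) R M"
proof -
  define y where "y i = (\<lambda>z. if x z = 0 \<and> (\<exists>v<i. x v \<noteq> 0 \<and> z \<in> set (adj ! v)) then k + 1 else x z)"
    for i
  let ?I = "\<lambda>i R M. R 12 = k + 1 \<and> state_inv a w U (y i) k R M"
  let ?body = "Seq (Add 11 3 7) (Seq (Load 11 11)
      (If (Neq 11 13) (If (Leq 11 10) (Seq load_list prog_scan) skip) skip))"
  have "wp B (for_verts ?body) (\<lambda>t R M. t \<le> (\<Sum>i<n. (9 + 7 * deg i) + 2) + 2 \<and> ?I n R M)
      (R(12 := k + 1)) M"
  proof (rule wp_for_verts)
    show "?I 0 (R(12 := k + 1, 7 := 0)) M" using inv by (simp add: y_def)
  next
    fix i R M
    assume i: "i < n" "R 7 = i" and I: "?I i R M"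
    then have inv: "state_inv a w U (y i) k R M" by blast
    note D = state_invD[OF inv]
    have yB: "y i z < B" if "z < n" for z using x[OF that] k word' by (auto simp: y_def)
    have bounds: "N + i < B" "k + 1 < B" using i k word' by simp_all
    show "wp B ?body (\<lambda>t R M. t \<le> 9 + 7 * deg i \<and> R 7 = i \<and> R 1 = 1 \<and> ?I (Suc i) (R(7 := Suc i)) M) R M"
    proof (cases "x i = 0")
      case True
      have "state_inv a w U (y (Suc i)) k R M"
        by (rule state_inv_cong[OF inv]) (use True in \<open>auto simp: y_def less_Suc_eq\<close>)
      \<comment> \<open>By now \<open>i\<close> may have received the new label; in either case the
        tests skip its list.\<close>
      moreover have "y i i = 0 \<or> k < y i i" using True by (simp add: y_def)
      ultimately show ?thesis
        using D i I bounds yB by (intro wp_intros) auto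
    next
      case False
      then have yi: "y i i = x i" by (simp add: y_def)
      let ?R = "R(11 := i + 2, 8 := off i, 9 := off (Suc i))"
      have "wp B prog_scan (\<lambda>t R' M'. t \<le> 7 * deg i + 1 \<and> R' 7 = i \<and> R' 12 = k + 1 \<and>
          state_inv a w U (\<lambda>z. if y i z = 0 \<and> z \<in> set (adj ! i) then k + 1 else y i z) k R' M') ?R M"
        using wp_scan[of a w U "y i" k ?R M i "k + 1"] inv i I bounds yB by simp
      moreover have "(\<lambda>z. if y i z = 0 \<and> z \<in> set (adj ! i) then k + 1 else y i z) = y (Suc i)"
        using False by (intro ext) (simp add: y_def Ex_less_Suc)
      ultimately have scan: "wp B prog_scan (\<lambda>t R' M'. t \<le> 7 * deg i + 1 \<and> R' 7 = i \<and> R' 12 = k + 1 \<and>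
          state_inv a w U (y (Suc i)) k R' M') ?R M" by simp
      have load: "wp B load_list (\<lambda>t R' M'. t = 4 \<and> M' = M \<and> R' = ?R) (R(11 := x i)) M"
        using wp_load_list[of a w U "y i" k "R(11 := x i)" M i] inv i by simp
      have "wp B (Seq load_list prog_scan) (\<lambda>t R' M'. t \<le> 7 * deg i + 5 \<and> R' 7 = i \<and> R' 12 = k + 1 \<and>
          state_inv a w U (y (Suc i)) k R' M') (R(11 := x i)) M"
        by (rule wp_Seq, rule wp_mono[OF load], elim conjE, hypsubst, rule wp_mono[OF scan]) simp
      then have "wp B (Seq load_list prog_scan) (\<lambda>t R M. 4 + t \<le> 9 + 7 * deg i \<and> R 7 = i \<and> R 1 = 1 \<and>
          ?I (Suc i) (R(7 := Suc i)) M) (R(11 := x i)) M"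
        by (rule wp_mono) (auto dest: state_invD(3))
      then show ?thesis
        using D i bounds yB yi False x[OF i(1)]
        by (intro wp_Seq[of _ "Add 11 3 7"] wp_Seq[of _ "Load 11 11"] wp_Add wp_Load wp_If)
          (auto elim!: wp_mono)
    qed
  qed (auto simp: state_inv_def)
  moreover have "state_inv a w U
      (\<lambda>z. if x z = 0 \<and> (\<exists>v<n. x v \<noteq> 0 \<and> (v, z) \<in> parcs G) then k + 1 else x z) k R M"
    if "state_inv a w U (y n) k R M" for R M
    using that by (rule state_inv_cong) (use set_adj in \<open>auto simp: y_def\<close>)
  moreover have "(\<Sum>i<n. (9 + 7 * deg i) + 2) = 11 * n + 7 * length (concat adj)"
    by (simp add: sum.distrib sum_deg flip: sum_distrib_left)
  ultimately have "wp B (for_verts ?body) (\<lambda>t R M. 1 + (t + 1) \<le> 11 * n + 7 * length (concat adj) + 4 \<and>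
      R 12 = k + 1 \<and> state_inv a w U
        (\<lambda>z. if x z = 0 \<and> (\<exists>v<n. x v \<noteq> 0 \<and> (v, z) \<in> parcs G) then k + 1 else x z) k R M)
      (R(12 := k + 1)) M"
    by (elim wp_mono) simp
  then show ?thesis
    unfolding prog_expand_def using state_invD[OF inv] k word'
    by (intro wp_Seq wp_Add) (auto elim!: wp_mono intro!: wp_Move state_inv_reg(3))
qed

lemma wp_mark:
  assumes inv: "state_inv a w U x k R M" and x: "\<And>v. v < n \<Longrightarrow> x v < B"
  shows "wp B prog_mark (\<lambda>t R M. t \<le> 7 * n + 2 \<and> state_inv a w (U \<union> {v. x v \<noteq> 0}) x k R M) R M"
proof -
  let ?U = "\<lambda>i. U \<union> {v. v < i \<and> x v \<noteq> 0}"
  have "wp B prog_mark (\<lambda>t R M. t \<le> (\<Sum>i<n. 5 + 2) + 2 \<and> state_inv a w (?U n) x k R M) R M"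
    unfolding prog_mark_def
  proof (rule wp_for_verts)
    fix i R M
    assume i: "i < n" "R 7 = i" and inv: "state_inv a w (?U i) x k R M"
    have "state_inv a w (?U (Suc i)) x k R (M(N + n + i := 1))" if "x i \<noteq> 0"
      by (rule state_inv_cong[OF state_inv_mark[OF inv i(1)]]) (use that in \<open>auto simp: less_Suc_eq\<close>)
    moreover have "state_inv a w (?U (Suc i)) x k R M" if "x i = 0"
      by (rule state_inv_cong[OF inv]) (use that in \<open>auto simp: less_Suc_eq\<close>)
    ultimately show "wp B (Seq (Add 11 3 7) (Seq (Load 11 11)
        (If (Neq 11 13) (Seq (Add 11 4 7) (Store 11 1)) skip)))
        (\<lambda>t R M. t \<le> 5 \<and> R 7 = i \<and> R 1 = 1 \<and> state_inv a w (?U (Suc i)) x k (R(7 := Suc i)) M) R M"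
      using i state_invD[OF inv] word' x by (intro wp_intros) auto
  qed (use inv in \<open>auto simp: state_inv_def\<close>)
  then show ?thesis by (rule wp_mono) (auto elim: state_inv_cong)
qed

lemma wp_check:
  assumes inv: "state_inv a w U x k R M" and x: "\<And>v. v < n \<Longrightarrow> x v < B"
  shows "wp B prog_check (\<lambda>t R M. t \<le> 6 * n + 2 \<and>
    state_inv (if \<exists>v<n. x v = 0 then 1 else a) w U x k R M) R M"
proof -
  let ?a = "\<lambda>i. if \<exists>v<i. x v = 0 then 1 else a"
  have "wp B prog_check (\<lambda>t R M. t \<le> (\<Sum>i<n. 4 + 2) + 2 \<and> state_inv (?a n) w U x k R M) R M"
    unfolding prog_check_def
  proof (rule wp_for_verts)
    fix i R M
    assume i: "i < n" "R 7 = i" and inv: "state_inv (?a i) w U x k R M"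
    show "wp B (Seq (Add 11 3 7) (Seq (Load 11 11) (If (Eq 11 13) (Move 0 1) skip)))
        (\<lambda>t R M. t \<le> 4 \<and> R 7 = i \<and> R 1 = 1 \<and> state_inv (?a (Suc i)) w U x k (R(7 := Suc i)) M) R M"
    proof (cases "x i = 0")
      case True
      then have "?a (Suc i) = 1" by auto
      with True show ?thesis
        using i state_invD(2-)[OF inv] word' x inv
        by (intro wp_intros) (simp_all add: state_inv_reg(1)[where a = "?a i"])
    next
      case False
      then have "?a (Suc i) = ?a i" by (simp add: Ex_less_Suc)
      with False show ?thesis
        using i state_invD(2-)[OF inv] word' x inv by (intro wp_intros) simp_all
    qed
  qed (use inv in \<open>auto simp: state_inv_def\<close>)
  then show ?thesis by (rule wp_mono) simp
qed

lemma wp_init: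
  assumes "R = (\<lambda>_. 0)" "M = (\<lambda>c. if c < N then input_cells adj ! c else 0)"
  shows "wp B prog_init (\<lambda>t R M. t = 5 \<and> state_inv 0 0 {} (\<lambda>_. 0) 0 R M) R M"
proof -
  have "M 0 = n" "M (Suc n) = N"
    using assms cell_0 cell_off[of n] N_eq(1) N_eq(2) by simp_all
  then show ?thesis
    unfolding prog_init_def using assms(1) word'
    by (intro wp_intros) (auto simp: state_inv_def assms(2))
qed

end

section \<open>Correctness\<close>

locale ram_free_graph = connected_P2_3P1_free_graph G + ram_graph G adj B
  for G :: "nat pair_pre_digraph" and adj B
begin

definition ball :: "nat \<Rightarrow> nat \<Rightarrow> nat set" where
  "ball w d = {z. z < n \<and> hops w z \<le> d}"

text \<open>Only whether a label vanishes records membership in the ball. The bound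
  \<open>Suc d\<close> ensures that every labelled vertex passes the test of the next
  expansion.\<close>

definition labels_ball :: "nat \<Rightarrow> nat \<Rightarrow> (nat \<Rightarrow> nat) \<Rightarrow> bool" where
  "labels_ball w d x \<longleftrightarrow> (\<forall>v<n. x v \<le> Suc d \<and> (x v \<noteq> 0 \<longleftrightarrow> v \<in> ball w d))"

lemma ball_Suc:
  assumes "w < n" "z < n"
  shows "z \<in> ball w (Suc d) \<longleftrightarrow> z \<in> ball w d \<or> (\<exists>v \<in> ball w d. (v, z) \<in> parcs G)"
proof -
  have "\<exists>v<n. hops w v \<le> d \<and> (v, z) \<in> parcs G" if "hops w z = Suc d"
    using hops_pred[of w z d] assms that pverts_eq by (metis lessThan_iff order_refl)
  moreover have "hops w z \<le> Suc d" if "hops w v \<le> d" "(v, z) \<in> parcs G" for v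
    using hops_arc[of w v z] that assms pverts_eq by simp
  ultimately show ?thesis using assms by (auto simp: ball_def le_Suc_eq)
qed

lemma labels_ball_eq_0_iff: "labels_ball w d x \<Longrightarrow> v < n \<Longrightarrow> x v = 0 \<longleftrightarrow> d < hops w v"
  unfolding labels_ball_def ball_def by (metis (lifting) mem_Collect_eq not_le)

lemma labels_ball_less: "labels_ball w d x \<Longrightarrow> d \<le> 5 \<Longrightarrow> v < n \<Longrightarrow> x v < B"
  using word' unfolding labels_ball_def by fastforce

lemma labels_ball_Suc:
  assumes "labels_ball w d x" "w < n"
  shows "labels_ball w (Suc d)
    (\<lambda>z. if x z = 0 \<and> (\<exists>v<n. x v \<noteq> 0 \<and> (v, z) \<in> parcs G) then Suc d + 1 else x z)"
    (is "labels_ball _ _ ?x")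
  unfolding labels_ball_def
proof (intro allI impI conjI)
  fix z assume z: "z < n"
  show "?x z \<le> Suc (Suc d)" using assms(1) z by (simp add: labels_ball_def le_SucI)
  have "?x z \<noteq> 0 \<longleftrightarrow> x z \<noteq> 0 \<or> (\<exists>v<n. x v \<noteq> 0 \<and> (v, z) \<in> parcs G)" by auto
  also have "\<dots> \<longleftrightarrow> z \<in> ball w d \<or> (\<exists>v \<in> ball w d. (v, z) \<in> parcs G)"
    using assms(1) z unfolding labels_ball_def by (auto simp: ball_def)
  also have "\<dots> \<longleftrightarrow> z \<in> ball w (Suc d)" using ball_Suc assms(2) z by simp
  finally show "?x z \<noteq> 0 \<longleftrightarrow> z \<in> ball w (Suc d)" .
qed

text \<open>The largest label is one more than the radius because the source has label 1, 0 being
  reserved for unvisited vertices.\<close>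

definition explored :: "nat \<Rightarrow> nat \<Rightarrow> nat set \<Rightarrow> nat \<Rightarrow> (reg \<Rightarrow> nat) \<Rightarrow> (nat \<Rightarrow> nat) \<Rightarrow> bool" where
  "explored a w U d R M \<longleftrightarrow> (\<exists>x. state_inv a w U x (Suc d) R M \<and> labels_ball w d x)"

lemma wp_source_explored:
  assumes "state_inv a w U (\<lambda>_. 0) k R M" "w < n"
  shows "wp B prog_source (\<lambda>t R M. t = 3 \<and> explored a w U 0 R M) R M"
proof -
  have "labels_ball w 0 ((\<lambda>_. 0)(w := 1))"
    using assms(2) hops_eq_0_iff pverts_eq by (auto simp: labels_ball_def ball_def)
  with wp_source[OF assms] show ?thesis by (elim wp_mono) (auto simp: explored_def)
qed

lemma wp_expand_explored:
  assumes "explored a w U d R M" "w < n" "d \<le> 5" "e = Suc d"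
  shows "wp B prog_expand (\<lambda>t R M. t \<le> 11 * n + 7 * length (concat adj) + 4 \<and> explored a w U e R M) R M"
proof -
  obtain x where x: "state_inv a w U x (Suc d) R M" "labels_ball w d x"
    using assms(1) by (auto simp: explored_def)
  have "\<And>v. v < n \<Longrightarrow> x v \<le> Suc d" using x(2) by (simp add: labels_ball_def)
  with assms(3) show ?thesis
    using labels_ball_Suc[OF x(2) assms(2)]
    by (intro wp_mono[OF wp_expand[OF x(1)]]) (auto simp: explored_def assms(4))
qed

lemma wp_mark_explored:
  assumes "explored a w U d R M" "d \<le> 5"
  shows "wp B prog_mark (\<lambda>t R M. t \<le> 7 * n + 2 \<and> explored a w (U \<union> ball w d) d R M) R M"
proof -
  obtain x where x: "state_inv a w U x (Suc d) R M" "labels_ball w d x"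
    using assms(1) by (auto simp: explored_def)
  have "state_inv a w (U \<union> ball w d) x (Suc d) R M"
    if "state_inv a w (U \<union> {v. x v \<noteq> 0}) x (Suc d) R M" for R M
    using that by (rule state_inv_cong) (use x(2) in \<open>auto simp: labels_ball_def\<close>)
  then show ?thesis
    using labels_ball_less[OF x(2) assms(2)] x(2)
    by (intro wp_mono[OF wp_mark[OF x(1)]]) (auto simp: explored_def)
qed

lemma wp_check_explored:
  assumes "explored a w U 5 R M"
  shows "wp B prog_check (\<lambda>t R M. t \<le> 6 * n + 2 \<and> (\<exists>x k.
    state_inv (if \<exists>z<n. 6 \<le> hops w z then 1 else a) w U x k R M)) R M"
proof -
  obtain x where x: "state_inv a w U x (Suc 5) R M" "labels_ball w 5 x"
    using assms by (auto simp: explored_def)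
  have "x z = 0 \<longleftrightarrow> 6 \<le> hops w z" if "z < n" for z
    using labels_ball_eq_0_iff[OF x(2) that] by linarith
  then have eq: "(\<exists>v<n. x v = 0) \<longleftrightarrow> (\<exists>z<n. 6 \<le> hops w z)" by blast
  show ?thesis
    using labels_ball_less[OF x(2)] by (intro wp_mono[OF wp_check[OF x(1), unfolded eq]]) blast+
qed

text \<open>The bounds of the parts add up to \<open>85 * n + 35 * length (concat adj) + 32\<close>;
  the constants are rounded up. The pick is minimal with respect to the marks \<open>U\<close> from
  before the round.\<close>

lemma wp_round:
  assumes "state_inv a w0 U x0 k0 R M" "w0 < n"
  shows "wp B prog_round (\<lambda>t R M. t \<le> 120 * n + 40 * length (concat adj) + 40 \<and>
    (\<exists>w x k. w < n \<and> (\<forall>u<n. u \<notin> U \<longrightarrow> w \<notin> U \<and> deg w \<le> deg u) \<and>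
      state_inv (if \<exists>z<n. 6 \<le> hops w z then 1 else a) w (U \<union> ball w 1) x k R M)) R M"
  unfolding prog_round_def
  apply (rule wp_Seq_mono[OF wp_pick[OF assms]], elim conjE exE)
  apply (rule wp_Seq_mono[OF wp_clear], assumption, elim conjE)
  apply (rule wp_Seq_mono[OF wp_source_explored], assumption, assumption, elim conjE)
  apply (rule wp_Seq_mono[OF wp_expand_explored[where e = 1]], assumption, assumption, simp, simp, elim conjE)
  apply (rule wp_Seq_mono[OF wp_mark_explored], assumption, simp, elim conjE)
  apply (rule wp_Seq_mono[OF wp_expand_explored[where e = 2]], assumption, assumption, simp, simp, elim conjE)
  apply (rule wp_Seq_mono[OF wp_expand_explored[where e = 3]], assumption, assumption, simp, simp, elim conjE)
  apply (rule wp_Seq_mono[OF wp_expand_explored[where e = 4]], assumption, assumption, simp, simp, elim conjE)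
  apply (rule wp_Seq_mono[OF wp_expand_explored[where e = 5]], assumption, assumption, simp, simp, elim conjE)
  apply (rule wp_mono[OF wp_check_explored], assumption, elim conjE exE)
  apply (rule conjI, simp)
  apply (rule exI, rule exI, rule exI, rule conjI, assumption, rule conjI, assumption, assumption)
  done

text \<open>The invariant after \<open>j\<close> rounds, with \<open>W\<close> the set of picks. The
  existence of \<open>W\<close> is claimed only under a pair at distance 6: its end \<open>u\<close>
  stays unmarked and guarantees that every pick is fresh, whereas otherwise the marks may exhaust
  the graph and picks repeat.\<close>

definition good :: "nat \<Rightarrow> (reg \<Rightarrow> nat) \<Rightarrow> (nat \<Rightarrow> nat) \<Rightarrow> bool" where
  "good j R M \<longleftrightarrow> (\<exists>a w U x k. state_inv a w U x k R M \<and> w < n \<and>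
    (a = 0 \<or> a = 1 \<and> diam G = 6) \<and>
    (a = 0 \<longrightarrow> (\<forall>u<n. \<forall>v<n. 6 \<le> hops u v \<longrightarrow> u \<notin> U \<and>
      (\<exists>W. card W = j \<and> finite W \<and> independent W \<and> (\<forall>z \<in> W. ball z 1 \<subseteq> U)))))"

lemma wp_round_good:
  assumes "good j R M"
  shows "wp B prog_round (\<lambda>t R M. t \<le> 120 * n + 40 * length (concat adj) + 40 \<and> good (Suc j) R M) R M"
proof -
  from assms obtain a w0 U x0 k0 where
    inv: "state_inv a w0 U x0 k0 R M" "w0 < n" "a = 0 \<or> a = 1 \<and> diam G = 6" and
    picks: "\<And>u v. a = 0 \<Longrightarrow> u < n \<Longrightarrow> v < n \<Longrightarrow> 6 \<le> hops u v \<Longrightarrow> u \<notin> U \<and>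
      (\<exists>W. card W = j \<and> finite W \<and> independent W \<and> (\<forall>z \<in> W. ball z 1 \<subseteq> U))"
    unfolding good_def by metis
  have step: "good (Suc j) R M"
    if w: "w < n" "\<And>u. u < n \<Longrightarrow> u \<notin> U \<Longrightarrow> w \<notin> U \<and> deg w \<le> deg u"
      and R: "state_inv (if \<exists>z<n. 6 \<le> hops w z then 1 else a) w (U \<union> ball w 1) x k R M"
    for w x k R M
  proof -
    let ?a = "if \<exists>z<n. 6 \<le> hops w z then 1 else a"
    have diam: "?a = 0 \<or> ?a = 1 \<and> diam G = 6"
      using inv(3) w(1) diam_eq_6_iff pverts_eq by auto
    have picks': "u \<notin> U \<union> ball w 1 \<and>
        (\<exists>W. card W = Suc j \<and> finite W \<and> independent W \<and> (\<forall>z \<in> W. ball z 1 \<subseteq> U \<union> ball w 1))"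
      if uv: "u < n" "v < n" "6 \<le> hops u v" and "?a = 0" for u v
    proof -
      have a: "a = 0" and far: "\<not> 6 \<le> hops w v" using \<open>?a = 0\<close> uv(2) by (auto split: if_splits)
      obtain W where u: "u \<notin> U" and W: "card W = j" "finite W" "independent W" "\<forall>z \<in> W. ball z 1 \<subseteq> U"
        using picks[OF a uv] by blast
      have wU: "w \<notin> U" and deg: "deg w \<le> deg u" using w(2)[OF uv(1) u] by simp_all
      \<comment> \<open>As \<open>u\<close> is unmarked, the pick has degree at most
        \<open>deg u\<close>; in the closed neighbourhood of \<open>u\<close> it would inherit
        distance 6 from \<open>v\<close>, which the failed check excludes.\<close>
      have "\<not> hops u w \<le> 1"
        using peripheral_twin[of u v w] far deg uv w(1) pverts_eq by (auto simp: deg_eq_card)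
      then have "u \<notin> ball w 1" using hops_sym by (simp add: ball_def)
      \<comment> \<open>Closed neighbourhoods of earlier picks are marked, and \<open>w\<close> was
        not, so \<open>w\<close> extends the independent set.\<close>
      moreover have non: "z \<noteq> w \<and> (z, w) \<notin> parcs G \<and> (w, z) \<notin> parcs G" if "z \<in> W" for z
      proof -
        have "w \<notin> ball z 1" using W(4) that wU by blast
        moreover have "z < n" using W(3) that pverts_eq by (auto simp: independent_def)
        ultimately show ?thesis
          using hops_le_1_iff[of z w] w(1) pverts_eq arcs_symmetric by (auto simp: ball_def)
      qed
      then have "independent (insert w W)"
        using W(3) w(1) pverts_eq no_loops' unfolding independent_def by auto
      moreover have "card (insert w W) = Suc j" using W non by (subst card_insert_disjoint) auto
      moreover have "\<forall>z \<in> insert w W. ball z 1 \<subseteq> U \<union> ball w 1" using W(4) by blast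
      ultimately show ?thesis using u W(2) by (metis Un_iff finite_insert)
    qed
    show ?thesis
      unfolding good_def
      by (rule exI[of _ ?a], rule exI[of _ w], rule exI[of _ "U \<union> ball w 1"], rule exI[of _ x],
          rule exI[of _ k], intro conjI impI allI R diam w(1))
        (rule picks'[THEN conjunct1] picks'[THEN conjunct2]; assumption)+
  qed
  show ?thesis
    by (rule wp_mono[OF wp_round[OF inv(1,2)]], elim conjE exE, rule conjI, assumption,
        rule step, assumption, blast, assumption)
qed

text \<open>If the answer were wrongly 0, the unmarked \<open>u\<close> would be non-adjacent to all
  four picks and complete them to an independent set of size 5, against
  \<open>card_independent_le\<close>.\<close>

lemma good_4:
  assumes "good 4 R M"
  shows "R 0 = (if diam G = 6 then 1 else 0)"
proof -
  from assms obtain a w U x k where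
    a: "state_inv a w U x k R M" "a = 0 \<or> a = 1 \<and> diam G = 6" and
    picks: "\<And>u v. a = 0 \<Longrightarrow> u < n \<Longrightarrow> v < n \<Longrightarrow> 6 \<le> hops u v \<Longrightarrow> u \<notin> U \<and>
      (\<exists>W. card W = 4 \<and> finite W \<and> independent W \<and> (\<forall>z \<in> W. ball z 1 \<subseteq> U))"
    unfolding good_def by metis
  have "a \<noteq> 0" if "diam G = 6"
  proof
    assume "a = 0"
    from that obtain u v where uv: "u < n" "v < n" "6 \<le> hops u v"
      using diam_eq_6_iff pverts_eq by auto
    then obtain W where u: "u \<notin> U" and W: "card W = 4" "finite W" "independent W" "\<forall>z \<in> W. ball z 1 \<subseteq> U"
      using picks[OF \<open>a = 0\<close> uv] by blast
    have non: "z \<noteq> u \<and> (z, u) \<notin> parcs G \<and> (u, z) \<notin> parcs G" if "z \<in> W" for z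
    proof -
      have "u \<notin> ball z 1" using W(4) that u by blast
      moreover have "z < n" using W(3) that pverts_eq by (auto simp: independent_def)
      ultimately show ?thesis
        using hops_le_1_iff[of z u] uv(1) pverts_eq arcs_symmetric by (auto simp: ball_def)
    qed
    then have "independent (insert u W)"
      using W(3) uv(1) pverts_eq no_loops' unfolding independent_def by auto
    moreover have "card (insert u W) = 5" using W non by (subst card_insert_disjoint) auto
    ultimately show False using card_independent_le[of u v "insert u W"] uv pverts_eq by simp
  qed
  with a state_invD(1)[OF a(1)] show ?thesis by auto
qed

lemma exec_prog_diam6:
  obtains t R M where "exec B prog_diam6 (initial_state adj) t (R, M)"
    "t \<le> 480 * n + 160 * length (concat adj) + 165" "R 0 = (if diam G = 6 then 1 else 0)"
proof -
  \<comment> \<open>Initially nothing is marked and \<open>W\<close> is empty; the default pick 0 is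
    a vertex since \<open>n\<close> is positive.\<close>
  have start: "good 0 R M" if "state_inv 0 0 {} x 0 R M" for x R M
    using that n_pos unfolding good_def independent_def
    by (intro exI[of _ 0] exI[of _ "{}"] exI[of _ x]) (auto intro!: exI[of _ "{}"])
  have "wp B prog_diam6 (\<lambda>t R M. t \<le> 480 * n + 160 * length (concat adj) + 165 \<and>
      good (Suc (Suc (Suc (Suc 0)))) R M) (\<lambda>_. 0) (\<lambda>c. if c < N then input_cells adj ! c else 0)"
    unfolding prog_diam6_def
    apply (rule wp_Seq_mono[OF wp_init], rule refl, rule refl, elim conjE)
    apply (rule wp_Seq_mono[OF wp_round_good[OF start]], assumption, elim conjE)
    apply (rule wp_Seq_mono[OF wp_round_good], assumption, elim conjE)
    apply (rule wp_Seq_mono[OF wp_round_good], assumption, elim conjE)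
    apply (rule wp_mono[OF wp_round_good], assumption)
    apply simp
    done
  then obtain t R M where "exec B prog_diam6 (initial_state adj) t (R, M)"
    "t \<le> 480 * n + 160 * length (concat adj) + 165" "good (Suc (Suc (Suc (Suc 0)))) R M"
    unfolding wp_def initial_state_def N_def by blast
  moreover have "Suc (Suc (Suc (Suc 0))) = 4" by simp
  ultimately show thesis using that good_4 by metis
qed

end

section \<open>Word size and linear running time\<close>

lemma decidable_diam_eq_6:
  "decidable_in_linear_time connected_P2_3P1_free (\<lambda>G. diam G = 6)"
  unfolding decidable_in_linear_time_def
proof (rule exI[of _ prog_diam6], rule exI[of _ 1000], rule exI[of _ 4], intro allI impI)
  fix G adj
  assume "pair_graph G" "connected_P2_3P1_free G" and adj: "adjacency_lists G adj"
  then interpret connected_P2_3P1_free_graph G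
    by (simp add: connected_P2_3P1_free_graph_def connected_P2_3P1_free_graph_axioms_def
        connected_pair_graph_def connected_pair_graph_axioms_def connected_P2_3P1_free_def)
  define q where "q = num_verts G + num_edges G + 1"
  have nonempty: "adj \<noteq> []" using adj verts_nonempty by (auto simp: adjacency_lists_def)
  have n: "num_verts G = length adj" using adj by (simp add: adjacency_lists_def num_verts_def)
  \<comment> \<open>The smallest admissible word bound gives access to the estimate of the list
    lengths, from which the bound \<open>q ^ 4\<close> is then justified.\<close>
  interpret small: ram_graph G adj "length (input_cells adj) + 2 * length adj + 8"
    by unfold_locales (use adj nonempty in auto)
  \<comment> \<open>There is a vertex, so \<open>q\<close> is at least 2. Exponent 4 therefore
    yields \<open>8 * q\<close>, which covers the space of at most \<open>3 * n + 2 * m + 10\<close>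
    for \<open>n\<close> vertices and \<open>m\<close> edges.\<close>
  have "2 ^ 3 * q \<le> q ^ 3 * q"
    using n nonempty by (intro mult_right_mono power_mono) (cases adj; simp add: q_def)+
  then have "8 * q \<le> q ^ 4" by (simp add: power_numeral_reduce mult.assoc)
  moreover have "1 \<le> length adj" using nonempty by (cases adj) simp_all
  then have "length (input_cells adj) + 2 * length adj + 8 \<le> 8 * q"
    using small.length_concat_adj_le small.N_eq(2) n
    unfolding q_def small.N_def small.n_def by simp
  ultimately interpret ram_free_graph G adj "q ^ 4"
    using adj nonempty by unfold_locales linarith+
  obtain t R M where run: "exec (q ^ 4) prog_diam6 (initial_state adj) t (R, M)"
    "t \<le> 480 * n + 160 * length (concat adj) + 165" "R 0 = (if diam G = 6 then 1 else 0)"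
    by (rule exec_prog_diam6)
  \<comment> \<open>The additive 165 is absorbed by the at least one vertex:
    \<open>645 * a + 320 * e\<close> suffices.\<close>
  have "t \<le> 1000 * (a + e)" if "t \<le> 480 * a + 160 * l + 165" "1 \<le> a" "l \<le> 2 * e" for a e l
    using that by (simp add: distrib_left)
  from this[OF run(2), of "num_edges G"] have "t \<le> 1000 * (num_verts G + num_edges G)"
    using \<open>1 \<le> length adj\<close> length_concat_adj_le \<open>num_verts G = length adj\<close> by (simp add: n_def)
  with run(1,3) show "\<exists>t R M. exec ((num_verts G + num_edges G + 1) ^ 4) prog_diam6 (initial_state adj) t (R, M) \<and>
      t \<le> 1000 * (num_verts G + num_edges G) \<and> R 0 = (if diam G = 6 then 1 else 0)"
    unfolding q_def by (intro exI conjI)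
qed

theorem theorem16:
  shows "decidable_in_linear_time connected_P2_3P1_free (\<lambda>G. diam G = 6)
    \<and> d_max connected_P2_3P1_free = 6"
  using decidable_diam_eq_6 d_max_connected_P2_3P1_free by blast

end
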